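(* Let $c \geq 0$ be an arbitrary real constant. Then there exists $X_0 = X_0(c) \geq 2$ such that for all real numbers $x \geq X_0$ and all real numbers $y$ with $x (\log x)^{-c} \leq y \leq x$, one has $$\pi(x+y) < \pi(x) + \pi(y).$$
   Context: For a real number $t \geq 1$, $\pi(t) = \#\{p \leq t : p \text{ is prime}\}$ denotes the prime counting function, and $\log$ is the natural logarithm. *)

theory Defs
  imports Complex_Main "HOL-Computational_Algebra.Primes"
begin

definition prime_pi :: "real \<Rightarrow> nat" where
  "prime_pi t = card {p :: nat. prime p \<and> real p \<le> t}"

end

theory Submission
  imports Defs "HOL-Complex_Analysis.Complex_Analysis" "HOL-Number_Theory.Prime_Powers"
    "HOL-Real_Asymp.Real_Asymp"
begin

text \<open>
  Put \<open>\<psi>(x) = \<Sum>n\<le>x. \<Lambda>(n)\<close>. The theorem follows from \<open>\<psi>(x) = x + O(x / ln x ^ m)\<close> for every \<open>m\<close>: on the one hand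
  \<open>(\<pi>(x + y) - \<pi>(x)) ln x \<le> \<psi>(x + y) - \<psi>(x)\<close>, on the other hand \<open>\<pi>(y) ln y\<close> exceeds \<open>y\<close> by a multiple of \<open>y / ln y\<close>,
  because small primes are undercounted by the weight \<open>ln p\<close>. For \<open>y \<ge> x / ln x ^ c\<close> this excess dominates the error
  term with \<open>m \<ge> c + 3\<close>.

  The error term is obtained by integrating in \<open>Re s > 1\<close> only. The inequality \<open>3 + 4 cos u + cos (2 u) \<ge> 0\<close> and elementary estimates
  for \<open>\<zeta>\<close> bound every derivative of \<open>- \<zeta>'/\<zeta> - \<zeta>\<close> by \<open>O((1 + \<bar>t\<bar>) powr (1/2))\<close>, uniformly in \<open>1 < Re s \<le> 2\<close>. The \<open>k\<close>-th
  derivative is the Dirichlet series with coefficients \<open>\<plusminus> (\<Lambda>(n) - 1) ln n ^ k\<close>, so Perron's formula for Riesz means gives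
  \<open>\<Sum>n\<le>x. (\<Lambda>(n) - 1) ln n ^ k (x - n) = O(x\<^sup>2)\<close>. Without the factor \<open>ln n ^ k\<close> this would be trivial; removing the smoothing
  and then the factor saves half of the \<open>k\<close> logarithms.
\<close>

section \<open>Dirichlet series\<close>

text \<open>Subtracting \<zeta> itself, rather than only \<open>1 / (s - 1)\<close>, cancels the
  pole at 1 and still leaves a Dirichlet series. Hence no residue has to be extracted, the bounds
  extend up to the line \<open>Re s = 1\<close>, and the abscissa of integration may depend on
  \<open>x\<close>. The price is that every logarithm saved has to be earned by a derivative, so all
  orders are needed. An error term with a fixed power of the logarithm would not do: the gain
  \<open>y / ln y\<close> can be as small as \<open>x / ln x ^ (c + 1)\<close>, and \<open>c\<close>
  is arbitrary. The exponent 1/2 is a convenient choice. Perron's kernel decays like the inverse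
  square of the height, so any exponent below 1 makes the integral converge absolutely. To reach it
  for the derivative of order \<open>k\<close>, the growth allowed to \<zeta> near the line must
  shrink with \<open>k\<close>; this is why the estimates there carry a free parameter
  \<open>e\<close>.\<close>

text \<open>Since \<open>0 powr z = 0\<close>, the term with index \<open>0\<close> vanishes.\<close>

definition dirichlet :: "(nat \<Rightarrow> real) \<Rightarrow> complex \<Rightarrow> complex" where
  "dirichlet c s = (\<Sum>n. of_real (c n) * of_nat n powr (- s))"

definition dirichlet_conv :: "(nat \<Rightarrow> real) \<Rightarrow> bool" where
  "dirichlet_conv c \<longleftrightarrow> (\<forall>\<sigma>>1. summable (\<lambda>n. \<bar>c n\<bar> * real n powr (- \<sigma>)))"

lemma norm_nat_powr: "norm (of_nat n powr (- s) :: complex) = real n powr (- Re s)"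
  by (cases "n = 0") (auto simp: norm_powr_real_powr)

lemma norm_dirichlet_term: "norm (of_real (c n) * of_nat n powr (- s) :: complex) = \<bar>c n\<bar> * real n powr (- Re s)"
  by (simp add: norm_mult norm_nat_powr)

lemma dirichlet_conv_abs_summable:
  assumes "dirichlet_conv c" "Re s > 1"
  shows "summable (\<lambda>n. norm (of_real (c n) * of_nat n powr (- s) :: complex))"
  using assms unfolding norm_dirichlet_term dirichlet_conv_def by blast

lemma dirichlet_conv_summable:
  assumes "dirichlet_conv c" "Re s > 1"
  shows "summable (\<lambda>n. of_real (c n) * of_nat n powr (- s) :: complex)"
  using dirichlet_conv_abs_summable[OF assms] by (rule summable_norm_cancel)

lemma dirichlet_conv_mono:
  assumes "dirichlet_conv c" "\<And>n. n > 0 \<Longrightarrow> \<bar>d n\<bar> \<le> \<bar>c n\<bar>"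
  shows "dirichlet_conv d"
  unfolding dirichlet_conv_def
proof (intro allI impI)
  fix \<sigma> :: real assume "\<sigma> > 1"
  then have "summable (\<lambda>n. \<bar>c n\<bar> * real n powr (- \<sigma>))"
    using assms(1) by (auto simp: dirichlet_conv_def)
  then show "summable (\<lambda>n. \<bar>d n\<bar> * real n powr (- \<sigma>))"
  proof (rule summable_comparison_test')
    show "norm (\<bar>d n\<bar> * real n powr (- \<sigma>)) \<le> \<bar>c n\<bar> * real n powr (- \<sigma>)" if "n \<ge> 0" for n
      using assms(2)[of n] by (cases "n = 0") (auto intro: mult_right_mono)
  qed
qed

lemma dirichlet_conv_one: "dirichlet_conv (\<lambda>_. 1)"
  by (auto simp: dirichlet_conv_def summable_real_powr_iff)

lemma dirichlet_conv_diff: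
  assumes "dirichlet_conv c" "dirichlet_conv d"
  shows "dirichlet_conv (\<lambda>n. c n - d n)"
  unfolding dirichlet_conv_def
proof (intro allI impI)
  fix \<sigma> :: real assume "\<sigma> > 1"
  then have "summable (\<lambda>n. \<bar>c n\<bar> * real n powr (- \<sigma>) + \<bar>d n\<bar> * real n powr (- \<sigma>))"
    using assms by (auto simp: dirichlet_conv_def intro: summable_add)
  then show "summable (\<lambda>n. \<bar>c n - d n\<bar> * real n powr (- \<sigma>))"
    by (rule summable_comparison_test')
       (auto simp flip: distrib_right intro!: mult_right_mono)
qed

text \<open>The logarithm is paid for by half of the distance to the abscissa 1:
  \<open>ln n \<le> n powr e / e\<close>, and \<open>\<sigma> - e\<close> still exceeds 1.\<close>

lemma dirichlet_conv_ln:
  assumes "dirichlet_conv c"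
  shows "dirichlet_conv (\<lambda>n. ln (real n) * c n)"
  unfolding dirichlet_conv_def
proof (intro allI impI)
  fix \<sigma> :: real assume \<sigma>: "\<sigma> > 1"
  define e where "e = (\<sigma> - 1) / 2"
  have e: "e > 0" "\<sigma> - e > 1" using \<sigma> by (auto simp: e_def field_simps)
  have "summable (\<lambda>n. inverse e * (\<bar>c n\<bar> * real n powr (- (\<sigma> - e))))"
    using assms e by (intro summable_mult) (auto simp: dirichlet_conv_def)
  then show "summable (\<lambda>n. \<bar>ln (real n) * c n\<bar> * real n powr (- \<sigma>))"
  proof (rule summable_comparison_test')
    fix n :: nat assume "n \<ge> 0"
    show "norm (\<bar>ln (real n) * c n\<bar> * real n powr (- \<sigma>)) \<le> inverse e * (\<bar>c n\<bar> * real n powr (- (\<sigma> - e)))"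
    proof (cases "n = 0")
      case False
      have "ln (real n) \<le> real n powr e / e"
        using False e by (intro ln_powr_bound) auto
      then have "ln (real n) * (\<bar>c n\<bar> * real n powr (- \<sigma>)) \<le> real n powr e / e * (\<bar>c n\<bar> * real n powr (- \<sigma>))"
        by (intro mult_right_mono) auto
      also have "\<dots> = inverse e * (\<bar>c n\<bar> * real n powr (- (\<sigma> - e)))"
        using False by (simp add: powr_diff powr_minus field_simps)
      finally show ?thesis using False by (simp add: abs_mult mult_ac)
    qed auto
  qed
qed

lemma dirichlet_conv_ln_power: "dirichlet_conv c \<Longrightarrow> dirichlet_conv (\<lambda>n. ln (real n) ^ k * c n)"
  by (induction k) (auto simp: mult.assoc dest: dirichlet_conv_ln)

lemma dirichlet_diff:
  assumes "dirichlet_conv c" "dirichlet_conv d" "Re s > 1"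
  shows "dirichlet (\<lambda>n. c n - d n) s = dirichlet c s - dirichlet d s"
  unfolding dirichlet_def using assms
  by (subst suminf_diff) (auto intro: dirichlet_conv_summable simp: algebra_simps)

text \<open>Termwise differentiation is justified on a half-plane whose edge lies midway between 1
  and \<open>Re s\<close>: there the differentiated series has a summable majorant independent of
  the point.\<close>

lemma dirichlet_has_derivative:
  assumes c: "dirichlet_conv c" and s: "Re s > 1"
  shows "(dirichlet c has_field_derivative - dirichlet (\<lambda>n. ln (real n) * c n) s) (at s)"
proof -
  define \<sigma> where "\<sigma> = (1 + Re s) / 2"
  have \<sigma>: "\<sigma> > 1" "\<sigma> < Re s" using s by (auto simp: \<sigma>_def)
  define S where "S = {z. Re z > \<sigma>}"
  define f' where "f' = (\<lambda>n z. - (of_real (ln (real n) * c n) * of_nat n powr (- z)) :: complex)"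
  have S: "convex S" "open S" "s \<in> S"
    using \<sigma> by (auto simp: S_def convex_halfspace_Re_gt open_halfspace_Re_gt)
  have "((\<lambda>z. \<Sum>n. of_real (c n) * of_nat n powr (- z)) has_field_derivative (\<Sum>n. f' n s)) (at s)"
  proof (rule has_field_derivative_series'(2)[of S _ f' s])
    show "((\<lambda>z. of_real (c n) * of_nat n powr (- z)) has_field_derivative f' n z) (at z within S)" for n z
    proof (cases "n = 0")
      case False
      then show ?thesis unfolding f'_def
        by (auto intro!: derivative_eq_intros has_field_derivative_powr_right[THEN DERIV_chain2])
    qed (auto simp: f'_def)
    show "uniformly_convergent_on S (\<lambda>n x. \<Sum>i<n. f' i x)"
    proof (rule Weierstrass_m_test')
      show "summable (\<lambda>n. \<bar>ln (real n) * c n\<bar> * real n powr (- \<sigma>))"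
        using dirichlet_conv_ln[OF c] \<sigma> by (auto simp: dirichlet_conv_def)
      show "norm (f' n x) \<le> \<bar>ln (real n) * c n\<bar> * real n powr (- \<sigma>)" if "x \<in> S" for n x
      proof -
        have "norm (f' n x) = \<bar>ln (real n) * c n\<bar> * real n powr (- Re x)"
          using norm_dirichlet_term[of "\<lambda>n. ln (real n) * c n" n x] unfolding f'_def norm_minus_cancel .
        also have "\<dots> \<le> \<bar>ln (real n) * c n\<bar> * real n powr (- \<sigma>)"
          using that by (cases "n = 0") (auto simp: S_def intro!: mult_left_mono powr_mono)
        finally show ?thesis .
      qed
    qed
    show "summable (\<lambda>n. of_real (c n) * of_nat n powr (- s))"
      using c s by (rule dirichlet_conv_summable)
  qed (use S in \<open>auto simp: interior_open\<close>)
  also have "(\<Sum>n. f' n s) = - dirichlet (\<lambda>n. ln (real n) * c n) s"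
    unfolding f'_def dirichlet_def using dirichlet_conv_summable[OF dirichlet_conv_ln[OF c] s] by (rule suminf_minus)
  finally show ?thesis unfolding dirichlet_def[abs_def] .
qed

lemma dirichlet_holomorphic: "dirichlet_conv c \<Longrightarrow> dirichlet c holomorphic_on {s. Re s > 1}"
  unfolding holomorphic_on_def field_differentiable_def
  using dirichlet_has_derivative has_field_derivative_at_within by blast

lemma higher_deriv_dirichlet:
  assumes "dirichlet_conv c" "Re s > 1"
  shows "(deriv ^^ k) (dirichlet c) s = (-1) ^ k * dirichlet (\<lambda>n. ln (real n) ^ k * c n) s"
  using assms(2)
proof (induction k arbitrary: s)
  case (Suc k)
  define d where "d = (\<lambda>n. ln (real n) ^ k * c n)"
  have "(deriv ^^ Suc k) (dirichlet c) s = deriv ((deriv ^^ k) (dirichlet c)) s" by simp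
  also have "\<dots> = deriv (\<lambda>z. (-1) ^ k * dirichlet d z) s"
  proof (rule deriv_cong_ev)
    show "\<forall>\<^sub>F z in nhds s. (deriv ^^ k) (dirichlet c) z = (-1) ^ k * dirichlet d z"
      using eventually_nhds_in_open[of "{s. Re s > 1}" s] Suc
      by (auto simp: open_halfspace_Re_gt d_def elim!: eventually_mono)
  qed auto
  also have "\<dots> = (-1) ^ k * (- dirichlet (\<lambda>n. ln (real n) * d n) s)"
    using Suc.prems dirichlet_conv_ln_power[OF assms(1), of k]
    by (intro DERIV_imp_deriv DERIV_cmult dirichlet_has_derivative) (auto simp: d_def)
  finally show ?case by (simp add: d_def mult.assoc)
qed auto

section \<open>The von Mangoldt function and the logarithm of zeta\<close>

lemma mangoldt_le_ln:
  assumes "n > 0"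
  shows "mangoldt n \<le> ln (real n)"
proof -
  have "(mangoldt n :: real) \<le> (\<Sum>d | d dvd n. mangoldt d)"
    using assms by (intro member_le_sum) (auto simp: mangoldt_nonneg)
  also have "\<dots> = ln (real n)" using mangoldt_sum[of n, where 'a = real] assms by simp
  finally show ?thesis .
qed

lemma dirichlet_conv_mangoldt: "dirichlet_conv mangoldt"
proof (rule dirichlet_conv_mono[OF dirichlet_conv_ln[OF dirichlet_conv_one]])
  show "\<bar>mangoldt n\<bar> \<le> \<bar>ln (real n) * 1\<bar>" if "n > 0" for n
    using mangoldt_le_ln[OF that] by (simp add: mangoldt_nonneg)
qed

text \<open>The divisor sum of \<open>mangoldt\<close> is \<open>ln\<close>. The double series over
  pairs \<open>(d, m)\<close> converges absolutely, so it may be regrouped by the product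
  \<open>n = d * m\<close>. Analytically this is the formula for the logarithmic derivative of
  \<zeta>.\<close>

lemma dirichlet_mangoldt_mult_dirichlet_one:
  assumes s: "Re s > 1"
  shows "dirichlet mangoldt s * dirichlet (\<lambda>_. 1) s = dirichlet (\<lambda>n. ln (real n)) s"
proof -
  define f g :: "nat \<Rightarrow> complex"
    where "f = (\<lambda>n. of_real (mangoldt n) * of_nat n powr (- s))"
      and "g = (\<lambda>n. of_real 1 * of_nat n powr (- s))"
  have f: "(f has_sum dirichlet mangoldt s) UNIV"
    unfolding dirichlet_def f_def using s
    by (intro norm_summable_imp_has_sum dirichlet_conv_abs_summable summable_sums dirichlet_conv_summable dirichlet_conv_mangoldt)
  have g: "(g has_sum dirichlet (\<lambda>_. 1) s) UNIV"
    unfolding dirichlet_def g_def using s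
    by (intro norm_summable_imp_has_sum dirichlet_conv_abs_summable summable_sums dirichlet_conv_summable dirichlet_conv_one)
  have af: "(\<lambda>x. norm (f x)) summable_on UNIV"
    unfolding f_def using dirichlet_conv_abs_summable[OF dirichlet_conv_mangoldt s]
    by (intro norm_summable_imp_summable_on) auto
  have ag: "(\<lambda>x. norm (g x)) summable_on UNIV"
    unfolding g_def using dirichlet_conv_abs_summable[OF dirichlet_conv_one s]
    by (intro norm_summable_imp_summable_on) auto
  have pos: "((\<lambda>(d, m). f d * g m) has_sum (dirichlet mangoldt s * dirichlet (\<lambda>_. 1) s)) (UNIV \<times> UNIV)"
  proof (rule has_sum_SigmaI)
    show "((\<lambda>m. case (d, m) of (d, m) \<Rightarrow> f d * g m) has_sum (f d * dirichlet (\<lambda>_. 1) s)) UNIV" for d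
      using has_sum_cmult_right[OF g, of "f d"] by simp
    show "((\<lambda>d. f d * dirichlet (\<lambda>_. 1) s) has_sum dirichlet mangoldt s * dirichlet (\<lambda>_. 1) s) UNIV"
      using has_sum_cmult_left[OF f] by simp
    show "(\<lambda>(d, m). f d * g m) summable_on UNIV \<times> UNIV"
    proof -
      have "(\<lambda>p. norm (case p of (d, m) \<Rightarrow> f d * g m)) summable_on UNIV \<times> UNIV"
      proof (rule summable_on_SigmaI)
        show "((\<lambda>m. norm (case (d, m) of (d, m) \<Rightarrow> f d * g m)) has_sum (norm (f d) * (\<Sum>\<^sub>\<infinity>m. norm (g m)))) UNIV" for d
          using has_sum_cmult_right[OF has_sum_infsum[OF ag]] by (simp add: norm_mult)
        show "(\<lambda>d. norm (f d) * (\<Sum>\<^sub>\<infinity>m. norm (g m))) summable_on UNIV"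
          using af by (rule summable_on_cmult_left)
      qed auto
      then show ?thesis by (rule abs_summable_summable)
    qed
  qed
  \<comment> \<open>Index 0 has to go before regrouping: 0 has infinitely many divisors, and
    \<open>m\<close> could not be recovered as \<open>n div d\<close>. Its terms are 0.\<close>
  have "((\<lambda>(d, m). f d * g m) has_sum (dirichlet mangoldt s * dirichlet (\<lambda>_. 1) s)) ({0<..} \<times> {0<..})"
    using pos by (rule has_sum_cong_neutral[THEN iffD1, rotated -1]) (auto simp: f_def g_def)
  also have "?this \<longleftrightarrow> ((\<lambda>(n, d). f d * g (n div d)) has_sum (dirichlet mangoldt s * dirichlet (\<lambda>_. 1) s))
      (SIGMA n:{0<..}. {d. d dvd n})"
    by (rule has_sum_reindex_bij_witness[of _ "\<lambda>(n, d). (d, n div d)" "\<lambda>(d, m). (d * m, d)"])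
       (auto elim!: dvdE)
  finally have "((\<lambda>n. \<Sum>d | d dvd n. f d * g (n div d)) has_sum (dirichlet mangoldt s * dirichlet (\<lambda>_. 1) s)) {0<..}"
    by (rule has_sum_SigmaD) (auto intro!: has_sum_finiteI)
  also have "?this \<longleftrightarrow> ((\<lambda>n. of_real (ln (real n)) * of_nat n powr (- s)) has_sum (dirichlet mangoldt s * dirichlet (\<lambda>_. 1) s)) UNIV"
  proof (rule has_sum_cong_neutral)
    fix n :: nat assume "n \<in> {0<..} \<inter> UNIV"
    then have n: "n > 0" by auto
    have "(\<Sum>d | d dvd n. f d * g (n div d)) = (\<Sum>d | d dvd n. of_real (mangoldt d) * of_nat n powr (- s))"
    proof (rule sum.cong)
      fix d assume "d \<in> {d. d dvd n}"
      then obtain m where m: "n = d * m" by auto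
      with n show "f d * g (n div d) = of_real (mangoldt d) * of_nat n powr (- s)"
        by (auto simp: f_def g_def powr_times_real)
    qed auto
    also have "\<dots> = of_real (\<Sum>d | d dvd n. mangoldt d) * of_nat n powr (- s)"
      by (simp add: sum_distrib_right)
    also have "\<dots> = of_real (ln (real n)) * of_nat n powr (- s)"
      using n mangoldt_sum[of n, where 'a = real] by simp
    finally show "(\<Sum>d | d dvd n. f d * g (n div d)) = of_real (ln (real n)) * of_nat n powr (- s)" .
  qed auto
  finally have "(\<lambda>n. of_real (ln (real n)) * of_nat n powr (- s)) sums (dirichlet mangoldt s * dirichlet (\<lambda>_. 1) s)"
    by (rule has_sum_imp_sums)
  then show ?thesis unfolding dirichlet_def by (rule sums_unique)
qed

text \<open>The coefficient is \<open>1 / j\<close> at a prime power \<open>p ^ j\<close> and 0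
  elsewhere, so this is the logarithm of the Euler product, free of any choice of branch.\<close>

definition log_zeta :: "complex \<Rightarrow> complex" where
  "log_zeta = dirichlet (\<lambda>n. mangoldt n / ln (real n))"

lemma dirichlet_conv_mangoldt_div_ln: "dirichlet_conv (\<lambda>n. mangoldt n / ln (real n))"
proof (rule dirichlet_conv_mono[OF dirichlet_conv_one])
  show "\<bar>mangoldt n / ln (real n)\<bar> \<le> \<bar>1\<bar>" if "n > 0" for n
    using mangoldt_le_ln[OF that] that by (auto simp: mangoldt_nonneg divide_simps)
qed

lemma log_zeta_has_derivative:
  assumes "Re s > 1"
  shows "(log_zeta has_field_derivative - dirichlet mangoldt s) (at s)"
proof -
  have "(\<lambda>n. ln (real n) * (mangoldt n / ln (real n))) = mangoldt"
  proof (rule ext)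
    fix n :: nat
    show "ln (real n) * (mangoldt n / ln (real n)) = mangoldt n"
    proof (cases "n > 1")
      \<comment> \<open>At 0 and 1 both sides are 0, since \<open>mangoldt\<close> vanishes
        there.\<close>
      case False
      then have "n = 0 \<or> n = Suc 0" by auto
      then show ?thesis by auto
    qed auto
  qed
  then show ?thesis
    using dirichlet_has_derivative[OF dirichlet_conv_mangoldt_div_ln assms] unfolding log_zeta_def by simp
qed

text \<open>The term \<open>n = 1\<close> alone gives 1. The bound serves to exclude a zero constant
  in the exponential formula for \<zeta>.\<close>

lemma dirichlet_one_real_ge_1:
  assumes "\<sigma> > 1"
  shows "norm (dirichlet (\<lambda>_. 1) (of_real \<sigma>)) \<ge> 1"
proof -
  have eq: "of_real 1 * of_nat n powr (- of_real \<sigma>) = (of_real (real n powr (- \<sigma>)) :: complex)" for n :: nat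
    by (subst powr_of_real[symmetric]) auto
  have sm: "summable (\<lambda>n. real n powr (- \<sigma>))"
    using assms by (simp add: summable_real_powr_iff)
  have "1 = (\<Sum>n\<in>{1}. real n powr (- \<sigma>))" by simp
  also have "\<dots> \<le> (\<Sum>n. real n powr (- \<sigma>))" using sm by (intro sum_le_suminf) auto
  also have "\<dots> \<le> norm (of_real (\<Sum>n. real n powr (- \<sigma>)) :: complex)" by simp
  also have "of_real (\<Sum>n. real n powr (- \<sigma>)) = dirichlet (\<lambda>_. 1) (of_real \<sigma>)"
    unfolding dirichlet_def eq using sm by (rule suminf_of_real)
  finally show ?thesis .
qed

text \<open>Only \<open>c \<noteq> 0\<close> matters below, so the limit at infinity, which would give \<open>c = 1\<close>, is not computed.\<close>

lemma dirichlet_one_eq_exp_log_zeta: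
  obtains c where "c \<noteq> 0" "\<And>s. Re s > 1 \<Longrightarrow> dirichlet (\<lambda>_. 1) s = c * exp (log_zeta s)"
proof -
  \<comment> \<open>The convolution identity for \<open>mangoldt\<close> says that both factors have
    opposite logarithmic derivatives; so the product is constant on the convex half-plane.\<close>
  have "\<exists>c. \<forall>s\<in>{s. Re s > 1}. dirichlet (\<lambda>_. 1) s * exp (- log_zeta s) = c"
  proof (rule has_field_derivative_zero_constant)
    show "convex {s. Re s > 1}" by (simp add: convex_halfspace_Re_gt)
    fix s :: complex assume "s \<in> {s. Re s > 1}"
    then have s: "Re s > 1" by auto
    show "((\<lambda>s. dirichlet (\<lambda>_. 1) s * exp (- log_zeta s)) has_field_derivative 0) (at s within {s. Re s > 1})"
    proof -
      have "((\<lambda>s. exp (- log_zeta s)) has_field_derivative exp (- log_zeta s) * - (- dirichlet mangoldt s)) (at s)"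
        by (rule DERIV_chain2[OF DERIV_exp DERIV_minus[OF log_zeta_has_derivative[OF s]]])
      from DERIV_mult[OF dirichlet_has_derivative[OF dirichlet_conv_one s] this]
      have "((\<lambda>s. dirichlet (\<lambda>_. 1) s * exp (- log_zeta s)) has_field_derivative 0) (at s)"
        using dirichlet_mangoldt_mult_dirichlet_one[OF s, symmetric] by (simp add: mult_ac)
      then show ?thesis by (rule has_field_derivative_at_within)
    qed
  qed
  then obtain c where c: "\<And>s. Re s > 1 \<Longrightarrow> dirichlet (\<lambda>_. 1) s * exp (- log_zeta s) = c" by auto
  show ?thesis
  proof (rule that)
    show "dirichlet (\<lambda>_. 1) s = c * exp (log_zeta s)" if "Re s > 1" for s
      using c[OF that] by (auto simp: exp_minus field_simps)
    show "c \<noteq> 0"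
      using c[of 2] dirichlet_one_real_ge_1[of 2] by auto
  qed
qed

text \<open>Mertens' inequality: the real parts of \<open>log_zeta\<close> at heights 0,
  \<open>t\<close>, \<open>2 * t\<close>, weighted by 3, 4, 1, have a nonnegative sum term by term.
  Exponentiating brings in the unknown constant factor of \<zeta> once per weight, hence its eighth
  power in the bound.\<close>

lemma three_four_one:
  obtains c :: real where "c > 0"
    "\<And>\<sigma> t. \<sigma> > 1 \<Longrightarrow> c \<le> norm (dirichlet (\<lambda>_. 1) (of_real \<sigma>)) ^ 3 * norm (dirichlet (\<lambda>_. 1) (Complex \<sigma> t)) ^ 4 *
        norm (dirichlet (\<lambda>_. 1) (Complex \<sigma> (2 * t)))"
proof -
  obtain c where c: "c \<noteq> 0" "\<And>s. Re s > 1 \<Longrightarrow> dirichlet (\<lambda>_. 1) s = c * exp (log_zeta s)"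
    using dirichlet_one_eq_exp_log_zeta by blast
  show ?thesis
  proof (rule that[of "norm c ^ 8"])
    show "norm c ^ 8 > 0" using c by simp
    fix \<sigma> t :: real assume \<sigma>: "\<sigma> > 1"
    define d where "d = (\<lambda>n. mangoldt n / ln (real n) :: real)"
    have d: "d n \<ge> 0" for n
      by (cases "n = 0") (auto simp: d_def mangoldt_nonneg)
    have dc: "dirichlet_conv d" unfolding d_def by (rule dirichlet_conv_mangoldt_div_ln)
    define T where "T = (\<lambda>n s. of_real (d n) * of_nat n powr (- s) :: complex)"
    have sm: "summable (\<lambda>n. T n s)" if "Re s > 1" for s
      unfolding T_def using dc that by (rule dirichlet_conv_summable)
    have ReT: "Re (T n (Complex \<sigma> t)) = d n * real n powr (- \<sigma>) * cos (t * ln (real n))" for n t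
    proof (cases "n = 0")
      case False
      have "- Complex \<sigma> t * of_real (ln (real n)) = Complex (- \<sigma> * ln (real n)) (- (t * ln (real n)))"
        by (simp add: complex_eq_iff)
      then have "of_nat n powr (- Complex \<sigma> t) = exp (Complex (- \<sigma> * ln (real n)) (- (t * ln (real n))))"
        using False unfolding powr_def by simp
      then show ?thesis using False by (simp add: T_def Re_exp powr_def)
    qed (simp add: T_def)
    have Re_sum: "(\<lambda>n. Re (T n s)) sums Re (log_zeta s)" if "Re s > 1" for s
      using bounded_linear.sums[OF bounded_linear_Re summable_sums[OF sm[OF that]]]
      by (simp add: log_zeta_def dirichlet_def d_def T_def)
    let ?r = "\<lambda>n. 3 * Re (T n (Complex \<sigma> 0)) + 4 * Re (T n (Complex \<sigma> t)) + Re (T n (Complex \<sigma> (2 * t)))"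
    have S: "?r sums (3 * Re (log_zeta (Complex \<sigma> 0)) + 4 * Re (log_zeta (Complex \<sigma> t)) + Re (log_zeta (Complex \<sigma> (2 * t))))"
      using \<sigma> by (intro sums_add sums_mult Re_sum) auto
    have P: "0 \<le> ?r n" for n
    proof -
      define x where "x = t * ln (real n)"
      have "?r n = d n * real n powr (- \<sigma>) * (3 + 4 * cos x + cos (2 * x))"
        unfolding ReT by (simp add: x_def algebra_simps)
      also have "3 + 4 * cos x + cos (2 * x) = 2 * (1 + cos x)\<^sup>2"
        unfolding cos_double_cos by (simp add: power2_eq_square algebra_simps)
      finally show "0 \<le> ?r n" using d[of n] by simp
    qed
    have "0 \<le> 3 * Re (log_zeta (Complex \<sigma> 0)) + 4 * Re (log_zeta (Complex \<sigma> t)) + Re (log_zeta (Complex \<sigma> (2 * t)))"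
      by (rule sums_le[OF P sums_zero S])
    then have "1 \<le> exp (3 * Re (log_zeta (Complex \<sigma> 0)) + 4 * Re (log_zeta (Complex \<sigma> t)) + Re (log_zeta (Complex \<sigma> (2 * t))))"
      by simp
    also have "\<dots> = exp (Re (log_zeta (Complex \<sigma> 0))) ^ 3 * exp (Re (log_zeta (Complex \<sigma> t))) ^ 4 * exp (Re (log_zeta (Complex \<sigma> (2 * t))))"
    proof -
      have "exp (3 * a) = exp a ^ 3" "exp (4 * a) = exp a ^ 4" for a :: real
        using exp_of_nat_mult[of 3 a] exp_of_nat_mult[of 4 a] by simp_all
      then show ?thesis by (simp only: exp_add)
    qed
    finally have "norm c ^ 8 * 1 \<le> norm c ^ 8 * (exp (Re (log_zeta (Complex \<sigma> 0))) ^ 3 * exp (Re (log_zeta (Complex \<sigma> t))) ^ 4 * exp (Re (log_zeta (Complex \<sigma> (2 * t)))))"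
      by (intro mult_left_mono) auto
    also have "\<dots> = norm (dirichlet (\<lambda>_. 1) (Complex \<sigma> 0)) ^ 3 * norm (dirichlet (\<lambda>_. 1) (Complex \<sigma> t)) ^ 4 *
        norm (dirichlet (\<lambda>_. 1) (Complex \<sigma> (2 * t)))"
    proof -
      have nz: "norm (dirichlet (\<lambda>_. 1) (Complex \<sigma> u)) = norm c * exp (Re (log_zeta (Complex \<sigma> u)))" for u
        using \<sigma> by (simp add: c norm_mult)
      have alg: "x ^ 8 * (u ^ 3 * v ^ 4 * w) = (x * u) ^ 3 * (x * v) ^ 4 * (x * w)" for x u v w :: real
      proof -
        have "x ^ 8 = x ^ 3 * x ^ 4 * x"
          by (simp only: power_add[symmetric] power_Suc2[symmetric]) simp
        then show ?thesis by (simp only: power_mult_distrib mult_ac)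
      qed
      show ?thesis unfolding nz by (rule alg)
    qed
    finally show "norm c ^ 8 \<le> norm (dirichlet (\<lambda>_. 1) (of_real \<sigma>)) ^ 3 * norm (dirichlet (\<lambda>_. 1) (Complex \<sigma> t)) ^ 4 *
        norm (dirichlet (\<lambda>_. 1) (Complex \<sigma> (2 * t)))"
      by (simp add: complex_of_real_def)
  qed
qed

section \<open>The zeta function to the right of 0\<close>

text \<open>The term is \<open>s - 1\<close> times the difference between \<open>x powr (- s)\<close> and its integral over \<open>[x, x + 1]\<close> at
\<open>x = Suc n\<close>; hence \<open>zeta_reg s\<close> is \<open>(s - 1) \<zeta>(s)\<close>, continued to \<open>Re s > 0\<close>.\<close>

definition zeta_term :: "nat \<Rightarrow> complex \<Rightarrow> complex" where
  "zeta_term n s = (s - 1) * of_nat (Suc n) powr (- s) + of_nat (Suc (Suc n)) powr (1 - s) - of_nat (Suc n) powr (1 - s)"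

definition zeta_reg :: "complex \<Rightarrow> complex" where
  "zeta_reg s = 1 + (\<Sum>n. zeta_term n s)"

text \<open>Mean value inequality on the real segment; for \<open>Re s \<ge> 0\<close> the
  derivative \<open>- s * z powr (- s - 1)\<close> is largest in modulus at the left end.\<close>

lemma powr_diff_bound:
  assumes x: "(x::real) > 0" and u: "x \<le> u" "u \<le> x + 1" and s: "Re s \<ge> 0"
  shows "norm ((of_real x :: complex) powr (- s) - of_real u powr (- s)) \<le> norm s * x powr (- Re s - 1)"
proof -
  define S where "S = closed_segment (of_real x :: complex) (of_real u)"
  have S: "\<exists>v. z = of_real v \<and> x \<le> v" if "z \<in> S" for z
    using that u unfolding S_def closed_segment_of_real by (auto simp: closed_segment_eq_real_ivl)
  have "norm ((of_real x :: complex) powr (- s) - of_real u powr (- s)) \<le> (norm s * x powr (- Re s - 1)) * norm (of_real x - of_real u :: complex)"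
  proof (rule field_differentiable_bound[of S])
    show "convex S" by (simp add: S_def)
    show "((\<lambda>z. z powr (- s)) has_field_derivative (- s) * z powr (- s - 1)) (at z within S)" if "z \<in> S" for z
      using S[OF that] x by (intro has_field_derivative_at_within[OF has_field_derivative_powr]) (auto simp: complex_nonpos_Reals_iff)
    show "norm ((- s) * z powr (- s - 1)) \<le> norm s * x powr (- Re s - 1)" if z: "z \<in> S" for z
    proof -
      obtain v where v: "z = of_real v" "x \<le> v" using S[OF z] by auto
      then have "norm (z powr (- s - 1)) = v powr (- Re s - 1)"
        using x by (simp add: norm_powr_real_powr)
      also have "\<dots> \<le> x powr (- Re s - 1)"
        using v x s by (intro powr_mono2') auto
      finally show ?thesis by (simp add: norm_mult mult_left_mono)
    qed
  qed (auto simp: S_def)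
  also have "norm (of_real x - of_real u :: complex) \<le> 1"
    using u by (simp flip: of_real_diff)
  then have "(norm s * x powr (- Re s - 1)) * norm (of_real x - of_real u :: complex) \<le> (norm s * x powr (- Re s - 1)) * 1"
    by (intro mult_left_mono) auto
  finally show ?thesis by simp
qed

lemma powr_diff_bound':
  assumes x: "(x::real) > 0" and u: "x \<le> u" and s: "Re s \<ge> 0"
  shows "norm ((of_real x :: complex) powr (- s) - of_real u powr (- s)) \<le> 2 * x powr (- Re s)"
proof -
  have "norm ((of_real x :: complex) powr (- s) - of_real u powr (- s)) \<le> norm ((of_real x :: complex) powr (- s)) + norm ((of_real u :: complex) powr (- s))"
    by (rule norm_triangle_ineq4)
  also have "\<dots> = x powr (- Re s) + u powr (- Re s)"
    using x u by (simp add: norm_powr_real_powr)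
  also have "u powr (- Re s) \<le> x powr (- Re s)"
    using x u s by (intro powr_mono2') auto
  finally show ?thesis by simp
qed

text \<open>Geometric mean of the trivial bound and the mean value bound. The exponent \<open>\<delta>\<close> trades decay in \<open>x\<close> against
growth in \<open>s\<close>, which gives the bound \<open>O(\<bar>t\<bar> powr \<epsilon>)\<close> for the zeta function near \<open>Re s = 1\<close> without truncating the series.\<close>

lemma powr_diff_bound_interpolated:
  assumes x: "(x::real) > 0" and u: "x \<le> u" "u \<le> x + 1" and s: "Re s > 0" and \<delta>: "0 \<le> \<delta>" "\<delta> \<le> 1"
  shows "norm ((of_real x :: complex) powr (- s) - of_real u powr (- s)) \<le> 2 * norm s powr \<delta> * x powr (- Re s - \<delta>)"
proof -
  have s0: "norm s > 0" using s by (auto simp: complex_eq_iff)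
  have eq: "norm s powr \<delta> * x powr (- Re s - \<delta>) = x powr (- Re s) * (norm s / x) powr \<delta>"
    using x s0 by (simp add: powr_diff powr_divide)
  show ?thesis
  proof (cases "norm s \<ge> x")
    case True
    have "2 * x powr (- Re s) * 1 \<le> 2 * x powr (- Re s) * (norm s / x) powr \<delta>"
      using True x \<delta> by (intro mult_left_mono ge_one_powr_ge_zero) auto
    then show ?thesis using powr_diff_bound'[OF x u(1), of s] s eq by simp
  next
    case False
    then have q: "0 \<le> norm s / x" "norm s / x \<le> 1" using x by (auto simp: divide_le_eq_1)
    have "norm s * x powr (- Re s - 1) = x powr (- Re s) * (norm s / x) powr 1"
      using x s0 by (simp add: powr_diff)
    also have "\<dots> \<le> x powr (- Re s) * (norm s / x) powr \<delta>"
      using q \<delta> by (intro mult_left_mono powr_mono') auto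
    also have "\<dots> \<le> 2 * (x powr (- Re s) * (norm s / x) powr \<delta>)" by simp
    finally show ?thesis using powr_diff_bound[OF x u, of s] s eq by simp
  qed
qed

text \<open>The term is the increment over \<open>[x, x + 1]\<close> of a function
  \<open>\<phi>\<close> whose derivative at \<open>v\<close> is
  \<open>(s - 1) * (x powr (- s) - v powr (- s))\<close>. The interpolated bound for such
  differences thus passes to the term.\<close>

lemma norm_zeta_term_le:
  assumes s: "Re s > 0" and \<delta>: "0 \<le> \<delta>" "\<delta> \<le> 1"
  shows "norm (zeta_term n s) \<le> 2 * norm (s - 1) * norm s powr \<delta> * real (Suc n) powr (- Re s - \<delta>)"
proof -
  define x where "x = real (Suc n)"
  have x: "x > 0" by (simp add: x_def)
  define S where "S = closed_segment (of_real x :: complex) (of_real (x + 1))"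
  have S: "\<exists>v. z = of_real v \<and> x \<le> v \<and> v \<le> x + 1" if "z \<in> S" for z
    using that unfolding S_def closed_segment_of_real by (auto simp: closed_segment_eq_real_ivl)
  define \<phi> where "\<phi> = (\<lambda>z. (s - 1) * of_real x powr (- s) * z + z powr (1 - s))"
  define B where "B = 2 * norm (s - 1) * norm s powr \<delta> * x powr (- Re s - \<delta>)"
  have "norm (\<phi> (of_real (x + 1)) - \<phi> (of_real x)) \<le> B * norm (of_real (x + 1) - of_real x :: complex)"
  proof (rule field_differentiable_bound[of S])
    show "convex S" by (simp add: S_def)
    show "(\<phi> has_field_derivative (s - 1) * of_real x powr (- s) * 1 + (1 - s) * z powr (1 - s - 1)) (at z within S)" if "z \<in> S" for z
      unfolding \<phi>_def using S[OF that] x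
      by (intro DERIV_add DERIV_cmult DERIV_ident has_field_derivative_at_within[OF has_field_derivative_powr]) (auto simp: complex_nonpos_Reals_iff)
    show "norm ((s - 1) * of_real x powr (- s) * 1 + (1 - s) * z powr (1 - s - 1)) \<le> B" if z: "z \<in> S" for z
    proof -
      obtain v where v: "z = of_real v" "x \<le> v" "v \<le> x + 1" using S[OF z] by auto
      have "(s - 1) * of_real x powr (- s) * 1 + (1 - s) * z powr (1 - s - 1) = (s - 1) * (of_real x powr (- s) - of_real v powr (- s))"
        by (simp add: v(1) algebra_simps)
      also have "norm \<dots> \<le> norm (s - 1) * (2 * norm s powr \<delta> * x powr (- Re s - \<delta>))"
        unfolding norm_mult by (intro mult_left_mono powr_diff_bound_interpolated x v s \<delta>) auto
      finally show ?thesis by (simp add: B_def mult_ac)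
    qed
  qed (auto simp: S_def)
  also have "norm (of_real (x + 1) - of_real x :: complex) = 1" by simp
  also have "\<phi> (of_real (x + 1)) - \<phi> (of_real x) = zeta_term n s"
    by (simp add: \<phi>_def zeta_term_def x_def algebra_simps)
  finally show ?thesis by (simp add: B_def x_def)
qed

lemma summable_Suc_powr: "a < -1 \<Longrightarrow> summable (\<lambda>n. real (Suc n) powr a)"
  using summable_Suc_iff[of "\<lambda>n. real n powr a"] by (simp add: summable_real_powr_iff)

lemma zeta_term_holomorphic: "zeta_term n holomorphic_on S"
  unfolding zeta_term_def[abs_def] by (auto intro!: holomorphic_intros)

lemma open_right_halfplane: "open {s. Re s > a}"
  by (rule open_halfspace_Re_gt)

lemma zeta_reg_holomorphic: "zeta_reg holomorphic_on {s. Re s > 0}"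
proof -
  have "(\<lambda>s. \<Sum>n. zeta_term n s) holomorphic_on {s. Re s > 0}"
  proof (rule holomorphic_uniform_sequence)
    show "open {s. Re s > 0}" by (rule open_right_halfplane)
    show "(\<lambda>s. \<Sum>n<N. zeta_term n s) holomorphic_on {s. Re s > 0}" for N
      by (intro holomorphic_intros zeta_term_holomorphic)
    fix z assume "z \<in> {s. Re s > 0}"
    then have z: "Re z > 0" by simp
    define r where "r = Re z / 2"
    have r: "r > 0" using z by (simp add: r_def)
    have Re: "Re w \<ge> r" "norm w \<le> norm z + r" if "w \<in> cball z r" for w
    proof -
      have "\<bar>Re (z - w)\<bar> \<le> norm (z - w)" by (rule abs_Re_le_cmod)
      moreover have "norm (z - w) \<le> r" using that by (simp add: dist_norm)
      ultimately show "Re w \<ge> r" by (simp add: r_def)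
      have "norm w - norm z \<le> norm (w - z)" by (rule norm_triangle_ineq2)
      with \<open>norm (z - w) \<le> r\<close> show "norm w \<le> norm z + r" by (simp add: norm_minus_commute)
    qed
    have "uniform_limit (cball z r) (\<lambda>N s. \<Sum>n<N. zeta_term n s) (\<lambda>s. \<Sum>n. zeta_term n s) sequentially"
    proof (rule Weierstrass_m_test)
      show "summable (\<lambda>n. 2 * (norm z + r + 1) * (norm z + r) * real (Suc n) powr (- r - 1))"
        using r by (intro summable_mult summable_Suc_powr) auto
      fix n w assume w: "w \<in> cball z r"
      \<comment> \<open>With \<open>\<delta> = 1\<close> the decay exponent is
        \<open>- Re w - 1\<close>, summable for every positive real part.\<close>
      have "norm (zeta_term n w) \<le> 2 * norm (w - 1) * norm w powr 1 * real (Suc n) powr (- Re w - 1)"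
        using Re[OF w] r by (intro norm_zeta_term_le) auto
      also have "\<dots> \<le> 2 * (norm z + r + 1) * (norm z + r) * real (Suc n) powr (- r - 1)"
        using Re[OF w] r norm_triangle_ineq4[of w 1] by (intro mult_mono powr_mono) auto
      finally show "norm (zeta_term n w) \<le> 2 * (norm z + r + 1) * (norm z + r) * real (Suc n) powr (- r - 1)" .
    qed
    moreover have "cball z r \<subseteq> {s. Re s > 0}" using Re r by force
    ultimately show "\<exists>d>0. cball z d \<subseteq> {s. Re s > 0} \<and> uniform_limit (cball z d) (\<lambda>N s. \<Sum>n<N. zeta_term n s) (\<lambda>s. \<Sum>n. zeta_term n s) sequentially"
      using r by blast
  qed
  then show ?thesis unfolding zeta_reg_def[abs_def] by (intro holomorphic_intros)
qed

lemma zeta_reg_1: "zeta_reg 1 = 1"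
proof -
  have "zeta_term n 1 = 0" for n by (simp add: zeta_term_def del: of_nat_Suc)
  then show ?thesis by (simp add: zeta_reg_def)
qed

text \<open>For \<open>Re s > 1\<close> the two parts of \<open>zeta_term\<close> can be summed
  separately. The power differences telescope to \<open>- 1\<close>, which the summand 1 in
  \<open>zeta_reg\<close> compensates.\<close>

lemma zeta_reg_eq_dirichlet:
  assumes s: "Re s > 1"
  shows "zeta_reg s = (s - 1) * dirichlet (\<lambda>_. 1) s"
proof -
  have "(\<lambda>n. of_real 1 * of_nat n powr (- s)) sums dirichlet (\<lambda>_. 1) s"
    unfolding dirichlet_def using s by (intro summable_sums dirichlet_conv_summable dirichlet_conv_one)
  then have "(\<lambda>n. of_nat (Suc n) powr (- s)) sums dirichlet (\<lambda>_. 1) s"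
    using sums_Suc_iff[of "\<lambda>n. of_real 1 * of_nat n powr (- s)" "dirichlet (\<lambda>_. 1) s"] by simp
  then have 1: "(\<lambda>n. (s - 1) * of_nat (Suc n) powr (- s)) sums ((s - 1) * dirichlet (\<lambda>_. 1) s)"
    by (rule sums_mult)
  have "(\<lambda>n. real (Suc n) powr (1 - Re s)) \<longlonglongrightarrow> 0"
    using s filterlim_compose[OF filterlim_real_sequentially filterlim_Suc]
    by (intro tendsto_neg_powr) auto
  then have "(\<lambda>n. norm ((of_nat (Suc n) :: complex) powr (1 - s))) \<longlonglongrightarrow> 0"
    using norm_nat_powr[of "Suc _" "s - 1"] by (simp del: of_nat_Suc)
  then have "(\<lambda>n. (of_nat (Suc n) :: complex) powr (1 - s)) \<longlonglongrightarrow> 0"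
    by (rule tendsto_norm_zero_cancel)
  from telescope_sums[OF this]
  have 2: "(\<lambda>n. (of_nat (Suc (Suc n)) :: complex) powr (1 - s) - of_nat (Suc n) powr (1 - s)) sums (- 1)"
    by simp
  from sums_add[OF 1 2] have "(\<lambda>n. zeta_term n s) sums ((s - 1) * dirichlet (\<lambda>_. 1) s - 1)"
    by (simp add: zeta_term_def algebra_simps)
  then show ?thesis by (simp add: zeta_reg_def sums_iff)
qed

text \<open>This is \<zeta>(s) - 1 / (s - 1), with the removable singularity at 1 filled in.\<close>

definition zeta_nopole :: "complex \<Rightarrow> complex" where
  "zeta_nopole s = (if s = 1 then deriv zeta_reg 1 else (zeta_reg s - zeta_reg 1) / (s - 1))"

lemma zeta_nopole_holomorphic: "zeta_nopole holomorphic_on {s. Re s > 0}"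
  unfolding zeta_nopole_def[abs_def] by (rule pole_lemma_open[OF zeta_reg_holomorphic open_right_halfplane])

text \<open>Taking \<open>\<delta> = 2 * e\<close> in the term bound leaves the decay exponent
  \<open>- Re s - 2 * e \<le> - 1 - e\<close>, still summable slightly to the left of the line. The
  factor \<open>norm (s - 1)\<close> cancels against the denominator.\<close>

lemma norm_zeta_nopole_le:
  assumes e: "0 < e" "e \<le> 1/4"
  obtains C where "C > 0" "\<And>s. s \<noteq> 1 \<Longrightarrow> Re s \<ge> 1 - e \<Longrightarrow> norm (zeta_nopole s) \<le> C * norm s powr (2 * e)"
proof
  define K where "K = (\<Sum>n. real (Suc n) powr (- 1 - e))"
  have sm: "summable (\<lambda>n. real (Suc n) powr (- 1 - e))" using e by (intro summable_Suc_powr) auto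
  have "K > 0" unfolding K_def using sm by (intro suminf_pos) auto
  then show "2 * K > 0" by simp
  fix s :: complex assume s: "s \<noteq> 1" "Re s \<ge> 1 - e"
  have le: "norm (zeta_term n s) \<le> 2 * norm (s - 1) * norm s powr (2 * e) * real (Suc n) powr (- 1 - e)" for n
  proof -
    have "norm (zeta_term n s) \<le> 2 * norm (s - 1) * norm s powr (2 * e) * real (Suc n) powr (- Re s - 2 * e)"
      using s e by (intro norm_zeta_term_le) auto
    also have "\<dots> \<le> 2 * norm (s - 1) * norm s powr (2 * e) * real (Suc n) powr (- 1 - e)"
      using s by (intro mult_left_mono powr_mono) auto
    finally show ?thesis .
  qed
  have "norm (\<Sum>n. zeta_term n s) \<le> (\<Sum>n. 2 * norm (s - 1) * norm s powr (2 * e) * real (Suc n) powr (- 1 - e))"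
    by (intro norm_suminf_le le summable_mult sm)
  also have "\<dots> = 2 * norm (s - 1) * norm s powr (2 * e) * K"
    unfolding K_def using sm by (rule suminf_mult)
  finally have "norm (zeta_reg s - zeta_reg 1) \<le> 2 * norm (s - 1) * norm s powr (2 * e) * K"
    unfolding zeta_reg_1 by (simp add: zeta_reg_def)
  then show "norm (zeta_nopole s) \<le> 2 * K * norm s powr (2 * e)"
    using s by (simp add: zeta_nopole_def norm_divide divide_simps mult_ac)
qed

section \<open>The zeta function near the line \<open>Re s = 1\<close>\<close>

text \<open>At the pole the value is 0 by the convention for division, so statements about
  \<open>zeta\<close> have to keep away from 1.\<close>

definition zeta :: "complex \<Rightarrow> complex" where
  "zeta s = zeta_reg s / (s - 1)"

lemma zeta_reg_eq_zeta_nopole: "zeta_reg s = 1 + (s - 1) * zeta_nopole s"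
  by (cases "s = 1") (auto simp: zeta_nopole_def zeta_reg_1)

lemma zeta_eq_zeta_nopole: "s \<noteq> 1 \<Longrightarrow> zeta s = 1 / (s - 1) + zeta_nopole s"
  by (simp add: zeta_def zeta_reg_eq_zeta_nopole field_simps)

lemma zeta_eq_dirichlet: "Re s > 1 \<Longrightarrow> zeta s = dirichlet (\<lambda>_. 1) s"
  by (auto simp: zeta_def zeta_reg_eq_dirichlet)

lemma zeta_holomorphic: "zeta holomorphic_on {s. Re s > 0} - {1}"
  unfolding zeta_def[abs_def]
  by (intro holomorphic_intros holomorphic_on_subset[OF zeta_reg_holomorphic]) auto

lemma open_punctured: "open ({s. Re s > 0} - {1 :: complex})"
  by (intro open_Diff open_right_halfplane) auto

lemma zeta_has_derivative:
  assumes "Re s > 0" "s \<noteq> 1"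
  shows "(zeta has_field_derivative deriv zeta s) (at s)"
  using assms by (intro holomorphic_derivI[OF zeta_holomorphic open_punctured]) auto

definition growth :: "real \<Rightarrow> real \<Rightarrow> real" where
  "growth e t = (1 + \<bar>t\<bar>) powr (2 * e)"

lemma growth_ge_1: "e \<ge> 0 \<Longrightarrow> growth e t \<ge> 1"
  by (simp add: growth_def ge_one_powr_ge_zero)

text \<open>The condition on \<open>u\<close> covers both later uses: the doubled height in Mertens'
  inequality and the heights in a disk of radius at most 1 around a point of height
  \<open>t\<close>.\<close>

lemma growth_le_2:
  assumes "0 \<le> e" "e \<le> 1/4" "\<bar>u\<bar> \<le> 2 * \<bar>t\<bar> + 1"
  shows "growth e u \<le> 2 * growth e t"
proof -
  have "growth e u \<le> (2 * (1 + \<bar>t\<bar>)) powr (2 * e)"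
    unfolding growth_def using assms by (intro powr_mono2) auto
  also have "\<dots> = 2 powr (2 * e) * growth e t"
    unfolding growth_def by (subst powr_mult) auto
  also have "\<dots> \<le> 2 powr 1 * growth e t"
    using assms by (intro mult_right_mono powr_mono) (auto simp: growth_def)
  finally show ?thesis by simp
qed

text \<open>At distance \<open>\<eta>\<close> from the real axis the pole contributes at most
  \<open>1 / \<eta>\<close>. The generous right end 5 leaves room for Cauchy disks.\<close>

lemma zeta_bound:
  assumes e: "0 < e" "e \<le> 1/4" and \<eta>: "\<eta> > 0"
  obtains C where "C > 0"
    "\<And>s. \<bar>Im s\<bar> \<ge> \<eta> \<Longrightarrow> 1 - e \<le> Re s \<Longrightarrow> Re s \<le> 5 \<Longrightarrow> norm (zeta s) \<le> C * growth e (Im s)"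
proof -
  obtain C where C: "C > 0" "\<And>s. s \<noteq> 1 \<Longrightarrow> Re s \<ge> 1 - e \<Longrightarrow> norm (zeta_nopole s) \<le> C * norm s powr (2 * e)"
    by (rule norm_zeta_nopole_le[OF e]) (rule that, assumption, blast)
  show ?thesis
  proof (rule that)
    show "1 / \<eta> + 5 * C > 0" using C \<eta> by (simp add: add_pos_pos)
    fix s assume s: "\<bar>Im s\<bar> \<ge> \<eta>" "1 - e \<le> Re s" "Re s \<le> 5"
    have s1: "s \<noteq> 1" using s \<eta> by auto
    have "\<eta> \<le> norm (s - 1)" using s abs_Im_le_cmod[of "s - 1"] by simp
    then have "norm (1 / (s - 1)) \<le> 1 / \<eta> * 1"
      using \<eta> by (simp add: norm_divide frac_le)
    also have "\<dots> \<le> 1 / \<eta> * growth e (Im s)"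
      using \<eta> growth_ge_1[of e "Im s"] e by (intro mult_left_mono) auto
    finally have 1: "norm (1 / (s - 1)) \<le> 1 / \<eta> * growth e (Im s)" .
    have "norm s \<le> \<bar>Re s\<bar> + \<bar>Im s\<bar>" by (rule cmod_le)
    also have "\<dots> \<le> 5 * (1 + \<bar>Im s\<bar>)" using s e by auto
    finally have "norm s powr (2 * e) \<le> (5 * (1 + \<bar>Im s\<bar>)) powr (2 * e)"
      using e by (intro powr_mono2) auto
    also have "\<dots> = 5 powr (2 * e) * growth e (Im s)" unfolding growth_def by (subst powr_mult) auto
    also have "\<dots> \<le> 5 powr 1 * growth e (Im s)" using e by (intro mult_right_mono powr_mono) (auto simp: growth_def)
    finally have "C * norm s powr (2 * e) \<le> 5 * C * growth e (Im s)" using C by simp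
    then have 2: "norm (zeta_nopole s) \<le> 5 * C * growth e (Im s)" using C(2)[OF s1 s(2)] by simp
    show "norm (zeta s) \<le> (1 / \<eta> + 5 * C) * growth e (Im s)"
      unfolding zeta_eq_zeta_nopole[OF s1] using 1 2 norm_triangle_ineq[of "1 / (s - 1)" "zeta_nopole s"] by (simp only: distrib_right)
  qed
qed

lemma Im_Re_disk:
  assumes "norm (w - s) \<le> r"
  shows "\<bar>Im w\<bar> \<ge> \<bar>Im s\<bar> - r" "\<bar>Im w\<bar> \<le> \<bar>Im s\<bar> + r" "Re w \<ge> Re s - r" "Re w \<le> Re s + r"
  using assms abs_Re_le_cmod[of "w - s"] abs_Im_le_cmod[of "w - s"] by auto

text \<open>Cauchy's estimate on a disk of fixed radius \<open>min (e / 2) (\<eta> / 2)\<close>;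
  halving both margins keeps the disk in the region where \<zeta> is bounded.\<close>

lemma deriv_zeta_bound:
  assumes e: "0 < e" "e \<le> 1/4" and \<eta>: "0 < \<eta>" "\<eta> \<le> 1"
  obtains D where "D > 0"
    "\<And>s. \<bar>Im s\<bar> \<ge> \<eta> \<Longrightarrow> 1 - e / 2 \<le> Re s \<Longrightarrow> Re s \<le> 4 \<Longrightarrow> norm (deriv zeta s) \<le> D * growth e (Im s)"
proof -
  obtain C where C: "C > 0" "\<And>s. \<bar>Im s\<bar> \<ge> \<eta> / 2 \<Longrightarrow> 1 - e \<le> Re s \<Longrightarrow> Re s \<le> 5 \<Longrightarrow> norm (zeta s) \<le> C * growth e (Im s)"
    using zeta_bound[OF e, of "\<eta> / 2"] \<eta> by auto
  define r where "r = min (e / 2) (\<eta> / 2)"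
  have r: "r > 0" "r \<le> e / 2" "r \<le> \<eta> / 2" using e \<eta> by (auto simp: r_def)
  show ?thesis
  proof (rule that)
    show "2 * C / r > 0" using C r by simp
    fix s assume s: "\<bar>Im s\<bar> \<ge> \<eta>" "1 - e / 2 \<le> Re s" "Re s \<le> 4"
    have sub: "cball s r \<subseteq> {s. Re s > 0} - {1}"
    proof
      fix w assume "w \<in> cball s r"
      then have "norm (w - s) \<le> r" by (simp add: dist_norm norm_minus_commute)
      from Im_Re_disk[OF this] show "w \<in> {s. Re s > 0} - {1}" using s r e \<eta> by auto
    qed
    have "norm ((deriv ^^ 1) zeta s) \<le> fact 1 * (2 * C * growth e (Im s)) / r ^ 1"
    proof (rule Cauchy_inequality)
      show "zeta holomorphic_on ball s r" "continuous_on (cball s r) zeta"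
        by (rule holomorphic_on_subset[OF zeta_holomorphic subset_trans[OF ball_subset_cball sub]])
           (rule holomorphic_on_imp_continuous_on[OF holomorphic_on_subset[OF zeta_holomorphic sub]])
      fix w assume "norm (s - w) = r"
      then have "norm (w - s) \<le> r" by (simp add: norm_minus_commute)
      note w = Im_Re_disk[OF this]
      have "norm (zeta w) \<le> C * growth e (Im w)" using w s r e \<eta> by (intro C) auto
      also have "\<dots> \<le> C * (2 * growth e (Im s))" using w C r e \<eta> s by (intro mult_left_mono growth_le_2) auto
      finally show "norm (zeta w) \<le> 2 * C * growth e (Im s)" by simp
    qed (use r in auto)
    then show "norm (deriv zeta s) \<le> 2 * C / r * growth e (Im s)" by simp
  qed
qed

text \<open>Mertens' inequality solved for its middle factor: \<zeta> at the real point is at most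
  of the order of its simple pole, and at the doubled height it has the growth bound.\<close>

lemma zeta_lower_right:
  assumes e: "0 < e" "e \<le> 1/4" and \<eta>: "0 < \<eta>"
  obtains c where "c > 0"
    "\<And>s. \<bar>Im s\<bar> \<ge> \<eta> \<Longrightarrow> 1 < Re s \<Longrightarrow> Re s \<le> 3 \<Longrightarrow> norm (zeta s) ^ 4 \<ge> c * (Re s - 1) ^ 3 / growth e (Im s)"
proof -
  obtain C where C: "C > 0" "\<And>s. \<bar>Im s\<bar> \<ge> \<eta> \<Longrightarrow> 1 - e \<le> Re s \<Longrightarrow> Re s \<le> 5 \<Longrightarrow> norm (zeta s) \<le> C * growth e (Im s)"
    by (rule zeta_bound[OF e \<eta>]) (rule that, assumption, blast)
  obtain K where K: "K > 0" "\<And>s. s \<noteq> 1 \<Longrightarrow> Re s \<ge> 1 - e \<Longrightarrow> norm (zeta_nopole s) \<le> K * norm s powr (2 * e)"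
    by (rule norm_zeta_nopole_le[OF e]) (rule that, assumption, blast)
  obtain c where c: "c > 0" "\<And>\<sigma> t. \<sigma> > 1 \<Longrightarrow> c \<le> norm (dirichlet (\<lambda>_. 1) (of_real \<sigma>)) ^ 3 * norm (dirichlet (\<lambda>_. 1) (Complex \<sigma> t)) ^ 4 *
        norm (dirichlet (\<lambda>_. 1) (Complex \<sigma> (2 * t)))"
    by (rule three_four_one) (rule that, assumption, blast)
  \<comment> \<open>The 1 is the pole. On \<open>1 < \<sigma> \<le> 3\<close> the rest is at most
    \<open>3 * K\<close>, and \<open>\<sigma> - 1 \<le> 2\<close> turns this into
    \<open>6 * K / (\<sigma> - 1)\<close>.\<close>
  define L where "L = 1 + 6 * K"
  have L: "L > 0" using K by (simp add: L_def)
  have real: "norm (zeta (of_real \<sigma>)) \<le> L / (\<sigma> - 1)" if \<sigma>: "1 < \<sigma>" "\<sigma> \<le> 3" for \<sigma> :: real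
  proof -
    have s1: "(of_real \<sigma> :: complex) \<noteq> 1" using \<sigma> by auto
    have "norm (zeta_nopole (of_real \<sigma>)) \<le> K * norm (of_real \<sigma> :: complex) powr (2 * e)" using \<sigma> e by (intro K s1) auto
    also have "norm (of_real \<sigma> :: complex) powr (2 * e) = \<sigma> powr (2 * e)" using \<sigma> by simp
    also have "\<sigma> powr (2 * e) \<le> \<sigma> powr 1" using \<sigma> e by (intro powr_mono) auto
    also have "\<sigma> powr 1 \<le> 3" using \<sigma> by simp
    finally have "norm (zeta_nopole (of_real \<sigma>)) \<le> 3 * K" using K by simp
    moreover have "6 * K / 2 \<le> 6 * K / (\<sigma> - 1)" using \<sigma> K by (intro divide_left_mono) auto
    ultimately have "norm (zeta_nopole (of_real \<sigma>)) \<le> 6 * K / (\<sigma> - 1)" by linarith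
    moreover have "norm (1 / (of_real \<sigma> - 1) :: complex) = 1 / (\<sigma> - 1)"
    proof -
      have "(1 / (of_real \<sigma> - 1) :: complex) = of_real (1 / (\<sigma> - 1))" by simp
      then show ?thesis using \<sigma> by (simp only: norm_of_real) simp
    qed
    ultimately show ?thesis
      unfolding zeta_eq_zeta_nopole[OF s1] L_def add_divide_distrib using norm_triangle_ineq[of "1 / (of_real \<sigma> - 1)" "zeta_nopole (of_real \<sigma>)"]
      by linarith
  qed
  show ?thesis
  proof (rule that)
    show "c / (L ^ 3 * (2 * C)) > 0" using c L C by simp
    fix s assume s: "\<bar>Im s\<bar> \<ge> \<eta>" "1 < Re s" "Re s \<le> 3"
    define \<sigma> t where "\<sigma> = Re s" and "t = Im s"
    have s_eq: "s = Complex \<sigma> t" by (simp add: \<sigma>_def t_def)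
    have \<sigma>: "1 < \<sigma>" "\<sigma> \<le> 3" using s by (auto simp: \<sigma>_def)
    have growth: "growth e t > 0" using growth_ge_1[of e t] e by linarith
    have "norm (zeta (Complex \<sigma> (2 * t))) \<le> C * growth e (2 * t)"
      using C(2)[of "Complex \<sigma> (2 * t)"] s \<sigma> e \<eta> by (auto simp: t_def)
    also have "\<dots> \<le> C * (2 * growth e t)" using C e by (intro mult_left_mono growth_le_2) auto
    finally have b: "norm (zeta (Complex \<sigma> (2 * t))) \<le> 2 * C * growth e t" by simp
    have "c \<le> norm (zeta (of_real \<sigma>)) ^ 3 * norm (zeta (Complex \<sigma> t)) ^ 4 * norm (zeta (Complex \<sigma> (2 * t)))"
      using c(2)[of \<sigma> t] \<sigma> by (simp add: zeta_eq_dirichlet)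
    also have "\<dots> \<le> (L / (\<sigma> - 1)) ^ 3 * norm (zeta (Complex \<sigma> t)) ^ 4 * (2 * C * growth e t)"
      using real[OF \<sigma>] b \<sigma> L by (intro mult_mono power_mono) auto
    finally have "c * (\<sigma> - 1) ^ 3 \<le> (L ^ 3 * (2 * C)) * (norm (zeta s) ^ 4 * growth e t)"
      using \<sigma> by (simp add: power_divide field_simps s_eq)
    then show "c / (L ^ 3 * (2 * C)) * (Re s - 1) ^ 3 / growth e (Im s) \<le> norm (zeta s) ^ 4"
      using L C growth by (simp add: \<sigma>_def t_def field_simps)
  qed
qed

text \<open>Write \<open>\<tau> = growth e (Im s)\<close>. With \<open>\<delta> = a / \<tau>^5\<close> the lower bound \<open>c \<delta>^3 / \<tau>\<close> for \<open>\<bar>\<zeta>\<bar>^4\<close> at abscissa \<open>1 + \<delta>\<close> exceeds \<open>(4 D \<delta> \<tau>)^4\<close>, while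
\<open>\<zeta>\<close> varies by at most \<open>2 D \<delta> \<tau>\<close> between the abscissae \<open>1 - \<delta>\<close> and \<open>1 + \<delta>\<close>.\<close>

lemma zeta_near_line:
  assumes e: "0 < e" "e \<le> 1/4" and \<eta>: "0 < \<eta>" "\<eta> \<le> 1"
  obtains a where "a > 0" "a \<le> 1"
    "\<And>s. \<bar>Im s\<bar> \<ge> \<eta> \<Longrightarrow> 1 - a / growth e (Im s) ^ 5 \<le> Re s \<Longrightarrow> Re s \<le> 3 \<Longrightarrow>
      Re s > 0 \<and> zeta s \<noteq> 0 \<and> norm (deriv zeta s / zeta s) \<le> growth e (Im s) ^ 5 / (2 * a)"
proof -
  obtain D where D: "D > 0" "\<And>s. \<bar>Im s\<bar> \<ge> \<eta> \<Longrightarrow> 1 - e / 2 \<le> Re s \<Longrightarrow> Re s \<le> 4 \<Longrightarrow> norm (deriv zeta s) \<le> D * growth e (Im s)"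
    by (rule deriv_zeta_bound[OF e \<eta>]) (rule that, assumption, blast)
  obtain c where c: "c > 0" "\<And>s. \<bar>Im s\<bar> \<ge> \<eta> \<Longrightarrow> 1 < Re s \<Longrightarrow> Re s \<le> 3 \<Longrightarrow> norm (zeta s) ^ 4 \<ge> c * (Re s - 1) ^ 3 / growth e (Im s)"
    by (rule zeta_lower_right[OF e \<eta>(1)]) (rule that, assumption, blast)
  \<comment> \<open>The first entry keeps the abscissa where the derivative is bounded; in the
    second, \<open>256 * D ^ 4 = (4 * D) ^ 4\<close> comes from the comparison of fourth
    powers.\<close>
  define a where "a = min (e / 2) (c / (256 * D ^ 4))"
  have a': "a > 0" "a \<le> e / 2" "a \<le> c / (256 * D ^ 4)"
    using e c D by (auto simp: a_def)
  then have a: "a > 0" "a \<le> e / 2" "a \<le> 1" "256 * D ^ 4 * a \<le> c"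
    using e D by (auto simp: pos_le_divide_eq mult_ac)
  show ?thesis
  proof (rule that[OF a(1,3)])
    fix s assume s: "\<bar>Im s\<bar> \<ge> \<eta>" "1 - a / growth e (Im s) ^ 5 \<le> Re s" "Re s \<le> 3"
    define T where "T = growth e (Im s)"
    have T: "T \<ge> 1" unfolding T_def using e by (intro growth_ge_1) auto
    define \<delta> where "\<delta> = a / T ^ 5"
    have \<delta>: "\<delta> > 0" "\<delta> \<le> a"
      using a T by (auto simp: \<delta>_def divide_le_eq mult_le_cancel_left1)
    have \<delta>T: "\<delta> * T ^ 5 = a" using T by (simp add: \<delta>_def)
    have far: "norm (zeta w) \<ge> 4 * D * \<delta> * T" if w: "Im w = Im s" "1 + \<delta> \<le> Re w" "Re w \<le> 3" for w
    proof -
      have "(4 * D * \<delta> * T) ^ 4 = 256 * D ^ 4 * (\<delta> * T ^ 5) * \<delta> ^ 3 / T"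
        using T by (simp add: power_mult_distrib field_simps power_numeral_reduce)
      also have "\<dots> \<le> c * \<delta> ^ 3 / T"
        unfolding \<delta>T using a \<delta> T by (intro divide_right_mono mult_right_mono) auto
      also have "\<dots> \<le> c * (Re w - 1) ^ 3 / T"
        using w \<delta> c T by (intro divide_right_mono mult_left_mono power_mono) auto
      also have "\<dots> \<le> norm (zeta w) ^ 4"
        using c(2)[of w] w s \<delta> by (simp add: T_def)
      finally show ?thesis
        using power_le_imp_le_base[of "4 * D * \<delta> * T" 3 "norm (zeta w)"] by simp
    qed
    have Re: "Re s \<ge> 1 - \<delta>" using s by (simp add: \<delta>_def T_def)
    have lower: "norm (zeta s) \<ge> 2 * D * \<delta> * T"
    proof (cases "Re s \<ge> 1 + \<delta>")
      case True
      have "0 \<le> D * \<delta> * T" using D \<delta> T by simp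
      then show ?thesis using far[of s] True s by simp
    next
      case False
      define w where "w = Complex (1 + \<delta>) (Im s)"
      define S where "S = closed_segment s w"
      have S: "Im z = Im s \<and> Re s \<le> Re z \<and> Re z \<le> 1 + \<delta>" if z: "z \<in> S" for z
        using that False unfolding S_def w_def
        by (subst (asm) closed_segment_same_Im) (auto simp: closed_segment_eq_real_ivl)
      have "norm (zeta s - zeta w) \<le> D * T * norm (s - w)"
      proof (rule field_differentiable_bound[of S])
        show "convex S" by (simp add: S_def)
        fix z assume "z \<in> S"
        note z = S[OF this]
        show "(zeta has_field_derivative deriv zeta z) (at z within S)"
          using z s \<delta> a e \<eta> Re by (intro has_field_derivative_at_within[OF zeta_has_derivative]) auto
        show "norm (deriv zeta z) \<le> D * T"
          unfolding T_def using D(2)[of z] z s \<delta> a e \<eta> Re by auto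
      qed (auto simp: S_def)
      also have "s - w = of_real (Re s - (1 + \<delta>))" by (simp add: w_def complex_eq_iff)
      also have "norm (of_real (Re s - (1 + \<delta>)) :: complex) \<le> 2 * \<delta>"
        using False Re unfolding norm_of_real by linarith
      finally have "norm (zeta s - zeta w) \<le> 2 * D * \<delta> * T" using D T by (simp add: mult_ac)
      moreover have "norm (zeta w) \<ge> 4 * D * \<delta> * T" using \<delta> a e by (intro far) (auto simp: w_def)
      ultimately show ?thesis using norm_triangle_ineq2[of "zeta w" "zeta s"] by (simp add: norm_minus_commute)
    qed
    have pos: "2 * D * \<delta> * T > 0" using D \<delta> T by simp
    have "norm (deriv zeta s / zeta s) \<le> (D * T) / (2 * D * \<delta> * T)"
      unfolding norm_divide using D(2)[of s] s Re \<delta> a e lower pos D T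
      by (intro frac_le) (auto simp: T_def)
    also have "\<dots> = T ^ 5 / (2 * a)" using D T a by (simp add: \<delta>_def)
    finally show "Re s > 0 \<and> zeta s \<noteq> 0 \<and> norm (deriv zeta s / zeta s) \<le> growth e (Im s) ^ 5 / (2 * a)"
      using lower pos Re \<delta> a e by (auto simp: T_def)
  qed
qed

text \<open>To the right of the line this is the exponential formula. On the line it follows from
  the estimate near the line with \<open>\<eta>\<close> adapted to the height of \<open>s\<close>,
  except at 1, where the value is known.\<close>

lemma zeta_reg_nonzero:
  assumes "Re s \<ge> 1"
  shows "zeta_reg s \<noteq> 0"
proof (cases "Re s > 1")
  case True
  obtain c where "c \<noteq> 0" "\<And>s. Re s > 1 \<Longrightarrow> dirichlet (\<lambda>_. 1) s = c * exp (log_zeta s)"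
    by (rule dirichlet_one_eq_exp_log_zeta) (rule that, assumption, blast)
  then show ?thesis using True by (auto simp: zeta_reg_eq_dirichlet)
next
  case False
  with assms have Re: "Re s = 1" by simp
  show ?thesis
  proof (cases "s = 1")
    case True
    then show ?thesis by (simp add: zeta_reg_1)
  next
    case False
    with Re have Im: "Im s \<noteq> 0" by (auto simp: complex_eq_iff)
    obtain a where a: "a > 0" "a \<le> 1" "\<And>w. \<bar>Im w\<bar> \<ge> min 1 \<bar>Im s\<bar> \<Longrightarrow> 1 - a / growth (1/4) (Im w) ^ 5 \<le> Re w \<Longrightarrow> Re w \<le> 3 \<Longrightarrow>
      Re w > 0 \<and> zeta w \<noteq> 0 \<and> norm (deriv zeta w / zeta w) \<le> growth (1/4) (Im w) ^ 5 / (2 * a)"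
      using zeta_near_line[of "1/4" "min 1 \<bar>Im s\<bar>"] Im by auto
    have "zeta s \<noteq> 0" using a(3)[of s] a Re by (simp add: growth_def)
    then show ?thesis by (auto simp: zeta_def)
  qed
qed

section \<open>The generating function of \<Lambda>(n) - 1 and its derivatives\<close>

text \<open>This is -\<zeta>'/\<zeta> - \<zeta>. Both parts have the polar term
  \<open>1 / (s - 1)\<close>; written through \<open>zeta_reg\<close> and \<open>zeta_nopole\<close>
  it has already cancelled, so the point 1 needs no exception.\<close>

definition mangoldt_gf :: "complex \<Rightarrow> complex" where
  "mangoldt_gf s = - deriv zeta_reg s / zeta_reg s - zeta_nopole s"

definition zeta_reg_dom :: "complex set" where
  "zeta_reg_dom = {s. Re s > 0} \<inter> zeta_reg -` (- {0})"

lemma open_zeta_reg_dom: "open zeta_reg_dom"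
  unfolding zeta_reg_dom_def
  by (rule continuous_open_preimage) (auto intro: open_right_halfplane holomorphic_on_imp_continuous_on zeta_reg_holomorphic)

lemma mangoldt_gf_holomorphic: "mangoldt_gf holomorphic_on zeta_reg_dom"
  unfolding mangoldt_gf_def[abs_def]
  by (intro holomorphic_intros holomorphic_on_subset[OF zeta_reg_holomorphic] holomorphic_on_subset[OF zeta_nopole_holomorphic] open_zeta_reg_dom)
     (auto simp: zeta_reg_dom_def)

lemma mangoldt_gf_eq_dirichlet:
  assumes s: "Re s > 1"
  shows "mangoldt_gf s = dirichlet (\<lambda>n. mangoldt n - 1) s"
proof -
  have s1: "s \<noteq> 1" using s by auto
  have "(zeta_reg has_field_derivative 1 * dirichlet (\<lambda>_. 1) s + - dirichlet (\<lambda>n. ln (real n) * 1) s * (s - 1)) (at s)"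
  proof (rule has_field_derivative_transform_within_open)
    show "((\<lambda>s. (s - 1) * dirichlet (\<lambda>_. 1) s) has_field_derivative 1 * dirichlet (\<lambda>_. 1) s + - dirichlet (\<lambda>n. ln (real n) * 1) s * (s - 1)) (at s)"
      by (intro DERIV_mult dirichlet_has_derivative dirichlet_conv_one s) (auto intro!: derivative_eq_intros)
    show "open {s. Re s > 1}" by (rule open_right_halfplane)
  qed (use s in \<open>auto simp: zeta_reg_eq_dirichlet\<close>)
  then have "deriv zeta_reg s = dirichlet (\<lambda>_. 1) s - dirichlet mangoldt s * dirichlet (\<lambda>_. 1) s * (s - 1)"
    using dirichlet_mangoldt_mult_dirichlet_one[OF s] by (simp add: DERIV_imp_deriv)
  moreover have "zeta_reg s \<noteq> 0" using s by (intro zeta_reg_nonzero) auto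
  moreover have alg: "(z - D * z * b) / (b * z) = 1 / b - D" if "z \<noteq> 0" "b \<noteq> 0" for z b D :: complex
    using that by (simp add: field_simps)
  ultimately have "deriv zeta_reg s / zeta_reg s = 1 / (s - 1) - dirichlet mangoldt s"
    using s1 alg[of "dirichlet (\<lambda>_. 1) s" "s - 1"] by (simp add: zeta_reg_eq_dirichlet[OF s])
  moreover have "zeta_nopole s = dirichlet (\<lambda>_. 1) s - 1 / (s - 1)"
    using zeta_eq_zeta_nopole[OF s1] zeta_eq_dirichlet[OF s] by simp
  ultimately show ?thesis
    unfolding mangoldt_gf_def using s by (simp add: dirichlet_diff dirichlet_conv_mangoldt dirichlet_conv_one)
qed

lemma mangoldt_gf_eq_zeta:
  assumes s: "Re s > 0" "s \<noteq> 1" "zeta s \<noteq> 0"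
  shows "s \<in> zeta_reg_dom" "mangoldt_gf s = - deriv zeta s / zeta s - zeta s"
proof -
  show "s \<in> zeta_reg_dom" using s by (auto simp: zeta_reg_dom_def zeta_def)
  have "(zeta_reg has_field_derivative 1 * zeta s + deriv zeta s * (s - 1)) (at s)"
  proof (rule has_field_derivative_transform_within_open)
    show "((\<lambda>s. (s - 1) * zeta s) has_field_derivative 1 * zeta s + deriv zeta s * (s - 1)) (at s)"
      using s by (intro DERIV_mult zeta_has_derivative) (auto intro!: derivative_eq_intros)
    show "open ({s. Re s > 0} - {1 :: complex})" by (rule open_punctured)
  qed (use s in \<open>auto simp: zeta_def\<close>)
  then have "deriv zeta_reg s = zeta s + deriv zeta s * (s - 1)" by (simp add: DERIV_imp_deriv)
  moreover have "zeta_reg s = (s - 1) * zeta s" using s by (simp add: zeta_def)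
  moreover have alg: "(z + D * b) / (b * z) = 1 / b + D / z" if "z \<noteq> 0" "b \<noteq> 0" for z b D :: complex
    using that by (simp add: field_simps)
  ultimately have "deriv zeta_reg s / zeta_reg s = 1 / (s - 1) + deriv zeta s / zeta s"
    using s alg[of "zeta s" "s - 1"] by simp
  then show "mangoldt_gf s = - deriv zeta s / zeta s - zeta s"
    unfolding mangoldt_gf_def using zeta_eq_zeta_nopole[OF s(2)] by simp
qed

text \<open>Write \<open>\<tau> = growth e (Im s)\<close>. Cauchy's estimate on a disk of radius about \<open>\<tau> powr (-5)\<close> costs \<open>\<tau>^(5 (k + 1))\<close>; the exponent \<open>e\<close> is chosen to make
this \<open>\<bar>t\<bar> powr (1/2)\<close>.\<close>

lemma higher_deriv_mangoldt_gf_bound_far: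
  obtains C where "C > 0"
    "\<And>s. \<bar>Im s\<bar> \<ge> 1 \<Longrightarrow> 1 \<le> Re s \<Longrightarrow> Re s \<le> 2 \<Longrightarrow> norm ((deriv ^^ k) mangoldt_gf s) \<le> C * (1 + \<bar>Im s\<bar>) powr (1/2)"
proof -
  define e :: real where "e = 1 / (20 * (real k + 1))"
  have e: "0 < e" "e \<le> 1/4" by (auto simp: e_def field_simps)
  obtain C where C: "C > 0" "\<And>s. \<bar>Im s\<bar> \<ge> 1/2 \<Longrightarrow> 1 - e \<le> Re s \<Longrightarrow> Re s \<le> 5 \<Longrightarrow> norm (zeta s) \<le> C * growth e (Im s)"
    using zeta_bound[OF e, of "1/2"] by auto
  obtain a0 where a0: "a0 > 0" "a0 \<le> 1" "\<And>s. \<bar>Im s\<bar> \<ge> 1/2 \<Longrightarrow> 1 - a0 / growth e (Im s) ^ 5 \<le> Re s \<Longrightarrow> Re s \<le> 3 \<Longrightarrow>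
      Re s > 0 \<and> zeta s \<noteq> 0 \<and> norm (deriv zeta s / zeta s) \<le> growth e (Im s) ^ 5 / (2 * a0)"
    using zeta_near_line[OF e, of "1/2"] by auto
  define a where "a = min a0 e"
  have a: "a > 0" "a \<le> a0" "a \<le> e" using a0 e by (auto simp: a_def)
  \<comment> \<open>\<open>16 / a0\<close> is \<open>32 / (2 * a0)\<close>: inside the disk the
    growth factor may double, so its fifth power may grow by 32. The same 32 appears in the radius
    \<open>r\<close>.\<close>
  define M where "M = 16 / a0 + 2 * C"
  have M: "M > 0" using a0 C by (simp add: M_def add_pos_pos)
  show ?thesis
  proof (rule that)
    show "fact k * M * (32 / a) ^ k > 0" using M a by simp
    fix s assume s: "\<bar>Im s\<bar> \<ge> 1" "1 \<le> Re s" "Re s \<le> 2"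
    define T where "T = growth e (Im s)"
    have T: "T \<ge> 1" unfolding T_def using e by (intro growth_ge_1) auto
    then have T5: "T \<le> T ^ 5" "T ^ 5 \<ge> 1" using power_increasing[of 1 5 T] by auto
    define r where "r = a / (32 * T ^ 5)"
    have "a / (32 * T ^ 5) \<le> a / 32" using T T5 a by (intro divide_left_mono) auto
    then have r: "r > 0" "r \<le> a / 32" using a T by (auto simp: r_def)
    have w: "w \<noteq> 1 \<and> Re w > 0 \<and> zeta w \<noteq> 0 \<and> norm (mangoldt_gf w) \<le> M * T ^ 5" if "norm (w - s) \<le> r" for w
    proof -
      note w = Im_Re_disk[OF that]
      have tw: "growth e (Im w) \<le> 2 * T" unfolding T_def using w r a e s by (intro growth_le_2) auto
      have tw1: "growth e (Im w) \<ge> 1" using e by (intro growth_ge_1) auto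
      have tw5: "growth e (Im w) ^ 5 \<le> 32 * T ^ 5"
        using power_mono[OF tw, of 5] tw1 by (simp add: power_mult_distrib)
      have "r \<le> a0 / (32 * T ^ 5)" unfolding r_def using a T by (intro divide_right_mono) auto
      also have "\<dots> \<le> a0 / growth e (Im w) ^ 5" using tw5 tw1 a0(1) T by (intro divide_left_mono mult_pos_pos) auto
      finally have "1 - a0 / growth e (Im w) ^ 5 \<le> Re w" using w s by linarith
      moreover have Imw: "\<bar>Im w\<bar> \<ge> 1/2" using w s r a e by auto
      moreover have "Re w \<le> 3" using w s r a e by auto
      ultimately have z: "Re w > 0" "zeta w \<noteq> 0" "norm (deriv zeta w / zeta w) \<le> growth e (Im w) ^ 5 / (2 * a0)"
        using a0(3)[of w] by auto
      have w1: "w \<noteq> 1" using Imw by auto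
      have "norm (mangoldt_gf w) \<le> norm (deriv zeta w / zeta w) + norm (zeta w)"
        unfolding mangoldt_gf_eq_zeta(2)[OF z(1) w1 z(2)] using norm_triangle_ineq4[of "- (deriv zeta w / zeta w)" "zeta w"] by simp
      also have "norm (zeta w) \<le> C * growth e (Im w)" using Imw w s r a e by (intro C) auto
      also have "\<dots> \<le> C * (2 * T ^ 5)" using tw T5 C by (intro mult_left_mono) auto
      also have "norm (deriv zeta w / zeta w) \<le> 32 * T ^ 5 / (2 * a0)"
        using z(3) tw5 a0 by (meson divide_right_mono order_trans mult_nonneg_nonneg less_imp_le zero_le_numeral)
      finally have "norm (mangoldt_gf w) \<le> M * T ^ 5" by (simp add: M_def algebra_simps)
      with z w1 show ?thesis by auto
    qed
    have sub: "cball s r \<subseteq> zeta_reg_dom"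
    proof
      fix w assume "w \<in> cball s r"
      then have "norm (w - s) \<le> r" by (simp add: dist_norm norm_minus_commute)
      from w[OF this] show "w \<in> zeta_reg_dom" using mangoldt_gf_eq_zeta(1) by blast
    qed
    have "norm ((deriv ^^ k) mangoldt_gf s) \<le> fact k * (M * T ^ 5) / r ^ k"
    proof (rule Cauchy_inequality)
      show "mangoldt_gf holomorphic_on ball s r" "continuous_on (cball s r) mangoldt_gf"
        by (rule holomorphic_on_subset[OF mangoldt_gf_holomorphic subset_trans[OF ball_subset_cball sub]])
           (rule holomorphic_on_imp_continuous_on[OF holomorphic_on_subset[OF mangoldt_gf_holomorphic sub]])
      fix x assume "norm (s - x) = r"
      then show "norm (mangoldt_gf x) \<le> M * T ^ 5" using w[of x] by (simp add: norm_minus_commute)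
    qed (use r in auto)
    also have "\<dots> = fact k * M * (32 / a) ^ k * T ^ (5 * (k + 1))"
      using a T by (simp add: r_def power_divide power_mult_distrib power_mult[symmetric] power_add field_simps)
    also have "T ^ (5 * (k + 1)) = (1 + \<bar>Im s\<bar>) powr (2 * e * real (5 * (k + 1)))"
      unfolding T_def growth_def by (simp add: powr_powr flip: powr_realpow)
    also have "2 * e * real (5 * (k + 1)) = 1/2" by (simp add: e_def field_simps)
    finally show "norm ((deriv ^^ k) mangoldt_gf s) \<le> fact k * M * (32 / a) ^ k * (1 + \<bar>Im s\<bar>) powr (1/2)" .
  qed
qed

text \<open>Heights at least 1 are covered by Cauchy's estimate. The rest lies in a compact box
  whose left edge is on \<open>Re s = 1\<close> and contains 1; since \<open>mangoldt_gf\<close> is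
  holomorphic around this box, the bound stays uniform as \<open>Re s\<close> tends to 1.\<close>

lemma dirichlet_mangoldt_bound:
  obtains C where "C > 0"
    "\<And>s. 1 < Re s \<Longrightarrow> Re s \<le> 2 \<Longrightarrow>
      norm (dirichlet (\<lambda>n. ln (real n) ^ k * (mangoldt n - 1)) s) \<le> C * (1 + \<bar>Im s\<bar>) powr (1/2)"
proof -
  obtain C where C: "C > 0" "\<And>s. \<bar>Im s\<bar> \<ge> 1 \<Longrightarrow> 1 \<le> Re s \<Longrightarrow> Re s \<le> 2 \<Longrightarrow> norm ((deriv ^^ k) mangoldt_gf s) \<le> C * (1 + \<bar>Im s\<bar>) powr (1/2)"
    by (rule higher_deriv_mangoldt_gf_bound_far) (rule that, assumption, blast)
  define K where "K = cbox (Complex 1 (-1)) (Complex 2 1)"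
  have "K \<subseteq> zeta_reg_dom" by (auto simp: K_def zeta_reg_dom_def in_cbox_complex_iff zeta_reg_nonzero)
  then have "continuous_on K ((deriv ^^ k) mangoldt_gf)"
    using holomorphic_higher_deriv[OF mangoldt_gf_holomorphic open_zeta_reg_dom, of k]
    by (intro continuous_on_subset[OF holomorphic_on_imp_continuous_on])
  then have "compact ((deriv ^^ k) mangoldt_gf ` K)"
    by (intro compact_continuous_image) (auto simp: K_def)
  then obtain B where B: "B > 0" "\<And>s. s \<in> K \<Longrightarrow> norm ((deriv ^^ k) mangoldt_gf s) \<le> B"
  proof -
    from \<open>compact _\<close> have "bounded ((deriv ^^ k) mangoldt_gf ` K)" by (rule compact_imp_bounded)
    then obtain B where "B > 0" "\<forall>x\<in>(deriv ^^ k) mangoldt_gf ` K. norm x \<le> B" unfolding bounded_pos by blast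
    then show ?thesis using that by simp
  qed
  show ?thesis
  proof (rule that)
    show "B + C > 0" using B C by simp
    fix s assume s: "1 < Re s" "Re s \<le> 2"
    have one: "(1 + \<bar>Im s\<bar>) powr (1/2) \<ge> 1" by (intro ge_one_powr_ge_zero) auto
    have "norm ((deriv ^^ k) mangoldt_gf s) \<le> (B + C) * (1 + \<bar>Im s\<bar>) powr (1/2)"
    proof (cases "\<bar>Im s\<bar> \<ge> 1")
      case True
      then have "norm ((deriv ^^ k) mangoldt_gf s) \<le> C * (1 + \<bar>Im s\<bar>) powr (1/2)" using s by (intro C) auto
      also have "\<dots> \<le> (B + C) * (1 + \<bar>Im s\<bar>) powr (1/2)" using B by (intro mult_right_mono) auto
      finally show ?thesis .
    next
      case False
      then have "s \<in> K" using s by (auto simp: K_def in_cbox_complex_iff)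
      then have "norm ((deriv ^^ k) mangoldt_gf s) \<le> B * 1" using B by simp
      also have "\<dots> \<le> (B + C) * (1 + \<bar>Im s\<bar>) powr (1/2)" using B C one by (intro mult_mono) auto
      finally show ?thesis .
    qed
    also have "(deriv ^^ k) mangoldt_gf s = (deriv ^^ k) (dirichlet (\<lambda>n. mangoldt n - 1)) s"
    proof (rule higher_deriv_transform_within_open)
      show "mangoldt_gf holomorphic_on {s. Re s > 1}"
        by (rule holomorphic_on_subset[OF mangoldt_gf_holomorphic]) (auto simp: zeta_reg_dom_def zeta_reg_nonzero)
      show "dirichlet (\<lambda>n. mangoldt n - 1) holomorphic_on {s. Re s > 1}"
        by (intro dirichlet_holomorphic dirichlet_conv_diff dirichlet_conv_mangoldt dirichlet_conv_one)
    qed (use s in \<open>auto simp: open_right_halfplane mangoldt_gf_eq_dirichlet\<close>)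
    also have "\<dots> = (-1) ^ k * dirichlet (\<lambda>n. ln (real n) ^ k * (mangoldt n - 1)) s"
      using s by (intro higher_deriv_dirichlet dirichlet_conv_diff dirichlet_conv_mangoldt dirichlet_conv_one)
    finally show "norm (dirichlet (\<lambda>n. ln (real n) ^ k * (mangoldt n - 1)) s) \<le> (B + C) * (1 + \<bar>Im s\<bar>) powr (1/2)"
      by (simp add: norm_mult norm_power)
  qed
qed

section \<open>Perron's formula\<close>

text \<open>The kernel for Riesz means of order one. Compared with \<open>y powr s / s\<close>, the
  extra factor gives quadratic decay, hence absolute convergence on vertical lines.\<close>

definition perron_kern :: "real \<Rightarrow> complex \<Rightarrow> complex" where
  "perron_kern y s = of_real y powr s / (s * (s + 1))"

lemma contour_integral_rectpath_split:
  assumes "Re a1 \<le> Re a3" "Im a1 \<le> Im a3" "continuous_on (path_image (rectpath a1 a3)) f"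
  shows "contour_integral (rectpath a1 a3) f =
    contour_integral (linepath a1 (Complex (Re a3) (Im a1))) f +
    contour_integral (linepath (Complex (Re a3) (Im a1)) a3) f +
    contour_integral (linepath a3 (Complex (Re a1) (Im a3))) f +
    contour_integral (linepath (Complex (Re a1) (Im a3)) a1) f"
proof -
  define a2 a4 where "a2 = Complex (Re a3) (Im a1)" and "a4 = Complex (Re a1) (Im a3)"
  have eq: "rectpath a1 a3 = linepath a1 a2 +++ linepath a2 a3 +++ linepath a3 a4 +++ linepath a4 a1"
    by (simp add: rectpath_def a2_def a4_def Let_def)
  have "closed_segment a1 a2 \<subseteq> path_image (rectpath a1 a3)" "closed_segment a2 a3 \<subseteq> path_image (rectpath a1 a3)"
    "closed_segment a3 a4 \<subseteq> path_image (rectpath a1 a3)" "closed_segment a4 a1 \<subseteq> path_image (rectpath a1 a3)"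
    unfolding eq by (auto simp: path_image_join)
  then have "f contour_integrable_on linepath a1 a2" "f contour_integrable_on linepath a2 a3"
    "f contour_integrable_on linepath a3 a4" "f contour_integrable_on linepath a4 a1"
    using assms(3) by (auto intro!: contour_integrable_continuous_linepath elim: continuous_on_subset)
  then show ?thesis
    unfolding eq a2_def[symmetric] a4_def[symmetric]
    by (simp add: contour_integrable_joinI)
qed

lemma perron_kern_continuous_on:
  assumes "y > 0" "0 \<notin> S" "-1 \<notin> S"
  shows "continuous_on S (perron_kern y)"
proof -
  have "s + 1 \<noteq> 0" if "s \<in> S" for s using assms(3) that by (metis add_eq_0_iff2)
  then show ?thesis
    unfolding perron_kern_def[abs_def] using assms
    by (intro continuous_intros continuous_on_mult continuous_on_exp) (auto intro!: continuous_intros)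
qed

lemma norm_perron_kern_le:
  assumes "y > 0" "norm s \<ge> A" "norm (s + 1) \<ge> B" "A > 0" "B > 0" "y powr Re s \<le> M"
  shows "norm (perron_kern y s) \<le> M / (A * B)"
  unfolding perron_kern_def norm_divide norm_mult using assms
  by (intro frac_le mult_mono) (auto simp: norm_powr_real_powr intro: order_trans[OF powr_ge_zero])

lemma perron_kern_line_bound:
  assumes "y > 0" "a \<noteq> b" "A > 0" "B > 0" "norm (b - a) \<le> L"
    and "\<And>s. s \<in> closed_segment a b \<Longrightarrow> norm s \<ge> A \<and> norm (s + 1) \<ge> B \<and> y powr Re s \<le> M"
  shows "norm (contour_integral (linepath a b) (perron_kern y)) \<le> M / (A * B) * L"
proof -
  have *: "norm (perron_kern y s) \<le> M / (A * B)" if "s \<in> closed_segment a b" for s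
    using assms(6)[OF that] assms(1,3,4) by (intro norm_perron_kern_le) auto
  have nn: "0 \<le> M / (A * B)" using *[of a] by (meson ends_in_segment(1) norm_ge_zero order_trans)
  have "norm (contour_integral (linepath a b) (perron_kern y)) \<le> M / (A * B) * norm (b - a)"
  proof (rule contour_integral_bound_linepath[OF contour_integrable_continuous_linepath _ *])
    have "s \<noteq> 0 \<and> s \<noteq> -1" if "s \<in> closed_segment a b" for s
      using assms(6)[OF that] assms(3,4) by auto
    then show "continuous_on (closed_segment a b) (perron_kern y)"
      using assms(1) by (intro perron_kern_continuous_on) auto
  qed (use nn in auto)
  also have "\<dots> \<le> M / (A * B) * L" using nn assms(5) by (intro mult_left_mono)
  finally show ?thesis .
qed

lemma closed_segment_horizontal:
  assumes "s \<in> closed_segment (Complex a t) (Complex b t)"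
  shows "Im s = t \<and> min a b \<le> Re s \<and> Re s \<le> max a b"
  using assms by (subst (asm) closed_segment_same_Im) (auto simp: closed_segment_eq_real_ivl split: if_splits)

lemma closed_segment_vertical:
  assumes "s \<in> closed_segment (Complex c a) (Complex c b)"
  shows "Re s = c \<and> min a b \<le> Im s \<and> Im s \<le> max a b"
  using assms by (subst (asm) closed_segment_same_Re) (auto simp: closed_segment_eq_real_ivl split: if_splits)

lemma perron_kern_horizontal_bound:
  assumes "y > 0" "a \<noteq> b" "\<bar>t\<bar> = T" "T > 0" "\<bar>b - a\<bar> \<le> 2 * T"
    and "\<And>u. min a b \<le> u \<Longrightarrow> u \<le> max a b \<Longrightarrow> y powr u \<le> M"
  shows "norm (contour_integral (linepath (Complex a t) (Complex b t)) (perron_kern y)) \<le> 2 * M / T"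
proof -
  have "norm (contour_integral (linepath (Complex a t) (Complex b t)) (perron_kern y)) \<le> M / (T * T) * (2 * T)"
  proof (rule perron_kern_line_bound)
    show "norm (Complex b t - Complex a t) \<le> 2 * T"
      using assms(5) by (simp add: cmod_def)
    fix s assume "s \<in> closed_segment (Complex a t) (Complex b t)"
    from closed_segment_horizontal[OF this]
    show "norm s \<ge> T \<and> norm (s + 1) \<ge> T \<and> y powr Re s \<le> M"
      using abs_Im_le_cmod[of s] abs_Im_le_cmod[of "s + 1"] assms by auto
  qed (use assms in auto)
  also have "\<dots> = 2 * M / T" using assms by simp
  finally show ?thesis .
qed

lemma perron_kern_vertical_bound:
  assumes "y > 0" "T \<ge> 2" "\<bar>c\<bar> \<ge> T" "y powr c \<le> M" "a \<noteq> b" "\<bar>b - a\<bar> \<le> 2 * T"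
  shows "norm (contour_integral (linepath (Complex c a) (Complex c b)) (perron_kern y)) \<le> 4 * M / T"
proof -
  \<comment> \<open>\<open>norm (s + 1) \<ge> T - 1 \<ge> T / 2\<close>, which is where
    \<open>T \<ge> 2\<close> enters.\<close>
  have "norm (contour_integral (linepath (Complex c a) (Complex c b)) (perron_kern y)) \<le> M / (T * (T / 2)) * (2 * T)"
  proof (rule perron_kern_line_bound)
    show "norm (Complex c b - Complex c a) \<le> 2 * T"
      using assms by (simp add: cmod_def)
    fix s assume "s \<in> closed_segment (Complex c a) (Complex c b)"
    from closed_segment_vertical[OF this]
    show "norm s \<ge> T \<and> norm (s + 1) \<ge> T / 2 \<and> y powr Re s \<le> M"
      using abs_Re_le_cmod[of s] abs_Re_le_cmod[of "s + 1"] assms by auto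
  qed (use assms in auto)
  also have "\<dots> = 4 * M / T" using assms by simp
  finally show ?thesis .
qed

text \<open>For \<open>y \<ge> 1\<close> the contour is closed to the left, where
  \<open>y powr Re s\<close> does not grow. As \<open>T \<ge> 2\<close>, the rectangle encloses the
  poles 0 and -1, with residues 1 and \<open>- 1 / y\<close>. The other three sides cost 2 + 2 + 4 =
  8; \<open>\<sigma> \<le> 2\<close> bounds the horizontal ones by \<open>2 * T\<close> in
  length.\<close>

lemma perron_ge_1:
  assumes y: "y \<ge> 1" and \<sigma>: "0 < \<sigma>" "\<sigma> \<le> 2" and T: "T \<ge> 2"
  shows "norm (contour_integral (linepath (Complex \<sigma> (- T)) (Complex \<sigma> T)) (perron_kern y) - 2 * pi * \<i> * of_real (1 - 1 / y))
    \<le> 8 * y powr \<sigma> / T"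
proof -
  define a1 a3 where "a1 = Complex (- T) (- T)" and "a3 = Complex \<sigma> T"
  have a: "Re a1 \<le> Re a3" "Im a1 \<le> Im a3" "Re a1 = - T" "Im a1 = - T" "Re a3 = \<sigma>" "Im a3 = T"
    using \<sigma> T by (auto simp: a1_def a3_def)
  have img: "path_image (rectpath a1 a3) = cbox a1 a3 - box a1 a3"
    using a by (intro path_image_rectpath_cbox_minus_box) auto
  have box: "0 \<in> box a1 a3" "-1 \<in> box a1 a3" using a T \<sigma> by (auto simp: in_box_complex_iff)
  have w: "winding_number (rectpath a1 a3) 0 = 1" "winding_number (rectpath a1 a3) (-1) = 1"
    using box by (auto intro: winding_number_rectpath)
  have cauchy: "((\<lambda>s. of_real y powr s / (s - z)) has_contour_integral (2 * pi * \<i> * winding_number (rectpath a1 a3) z * of_real y powr z)) (rectpath a1 a3)"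
    if "z \<in> box a1 a3" for z
  proof (rule Cauchy_integral_formula_convex_simple[of UNIV])
    show "(\<lambda>s. of_real y powr s) holomorphic_on UNIV" using y by (intro holomorphic_intros) auto
    show "path_image (rectpath a1 a3) \<subseteq> UNIV - {z}" using that img by auto
  qed auto
  \<comment> \<open>Partial fractions of \<open>1 / (s * (s + 1))\<close>, so that Cauchy's formula
    applies to each pole separately.\<close>
  have "((\<lambda>s. of_real y powr s / (s - 0) - of_real y powr s / (s - (-1))) has_contour_integral
    (2 * pi * \<i> * 1 * of_real y powr 0 - 2 * pi * \<i> * 1 * of_real y powr (-1))) (rectpath a1 a3)"
    using has_contour_integral_diff[OF cauchy[OF box(1)] cauchy[OF box(2)]] unfolding w .
  moreover have "2 * pi * \<i> * 1 * of_real y powr 0 - 2 * pi * \<i> * 1 * of_real y powr (-1) = 2 * pi * \<i> * of_real (1 - 1 / y)"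
  proof -
    have "(of_real y :: complex) powr (of_real (-1)) = of_real (y powr (-1))"
      using y by (intro powr_of_real) auto
    then show ?thesis using y by (simp add: powr_minus field_simps)
  qed
  ultimately have "((\<lambda>s. of_real y powr s / (s - 0) - of_real y powr s / (s - (-1))) has_contour_integral
    (2 * pi * \<i> * of_real (1 - 1 / y))) (rectpath a1 a3)" by simp
  then have "(perron_kern y has_contour_integral (2 * pi * \<i> * of_real (1 - 1 / y))) (rectpath a1 a3)"
  proof (rule has_contour_integral_eq)
    fix s assume "s \<in> path_image (rectpath a1 a3)"
    then have "s \<noteq> 0" "s \<noteq> -1" using img box by auto
    then have "s \<noteq> 0" "s + 1 \<noteq> 0" by (auto simp: add_eq_0_iff2)
    then show "of_real y powr s / (s - 0) - of_real y powr s / (s - (-1)) = perron_kern y s"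
      by (simp add: perron_kern_def field_simps)
  qed
  then have tot: "contour_integral (rectpath a1 a3) (perron_kern y) = 2 * pi * \<i> * of_real (1 - 1 / y)"
    by (rule contour_integral_unique)
  have split: "contour_integral (rectpath a1 a3) (perron_kern y) =
    contour_integral (linepath (Complex (- T) (- T)) (Complex \<sigma> (- T))) (perron_kern y) +
    contour_integral (linepath (Complex \<sigma> (- T)) (Complex \<sigma> T)) (perron_kern y) +
    contour_integral (linepath (Complex \<sigma> T) (Complex (- T) T)) (perron_kern y) +
    contour_integral (linepath (Complex (- T) T) (Complex (- T) (- T))) (perron_kern y)"
    unfolding a1_def[symmetric] a3_def[symmetric]
    using contour_integral_rectpath_split[OF a(1,2), of "perron_kern y"] perron_kern_continuous_on[of y "path_image (rectpath a1 a3)"] y box img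
    by (auto simp: a)
  have mono: "y powr u \<le> y powr \<sigma>" if "u \<le> \<sigma>" for u using y that by (intro powr_mono) auto
  have h1: "norm (contour_integral (linepath (Complex (- T) (- T)) (Complex \<sigma> (- T))) (perron_kern y)) \<le> 2 * y powr \<sigma> / T"
    using y T \<sigma> by (intro perron_kern_horizontal_bound mono) auto
  have h2: "norm (contour_integral (linepath (Complex \<sigma> T) (Complex (- T) T)) (perron_kern y)) \<le> 2 * y powr \<sigma> / T"
    using y T \<sigma> by (intro perron_kern_horizontal_bound mono) auto
  have h3: "norm (contour_integral (linepath (Complex (- T) T) (Complex (- T) (- T))) (perron_kern y)) \<le> 4 * y powr \<sigma> / T"
    using y T \<sigma> by (intro perron_kern_vertical_bound mono) auto
  have tri: "norm (b - (a + b + c + d)) \<le> norm a + norm c + norm d" for a b c d :: complex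
    using norm_triangle_ineq[of "a + c" d] norm_triangle_ineq[of a c] norm_minus_cancel[of "a + c + d"]
    by (simp add: algebra_simps)
  have sum8: "8 * u / T = 2 * u / T + 2 * u / T + 4 * u / T" for u
    by (simp flip: add_divide_distrib)
  show ?thesis
    unfolding tot[symmetric] split
    by (rule order_trans[OF tri]) (use h1 h2 h3 sum8[of "y powr \<sigma>"] in linarith)
qed

text \<open>For \<open>y < 1\<close> the contour is closed to the right, where
  \<open>y powr Re s\<close> decreases and the kernel has no poles.\<close>

lemma perron_lt_1:
  assumes y: "0 < y" "y < 1" and \<sigma>: "0 < \<sigma>" "\<sigma> \<le> 2" and T: "T \<ge> 2"
  shows "norm (contour_integral (linepath (Complex \<sigma> (- T)) (Complex \<sigma> T)) (perron_kern y)) \<le> 8 * y powr \<sigma> / T"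
proof -
  define a1 a3 where "a1 = Complex \<sigma> (- T)" and "a3 = Complex (\<sigma> + T) T"
  have a: "Re a1 \<le> Re a3" "Im a1 \<le> Im a3" "Re a1 = \<sigma>" "Im a1 = - T" "Re a3 = \<sigma> + T" "Im a3 = T"
    using \<sigma> T by (auto simp: a1_def a3_def)
  have img: "path_image (rectpath a1 a3) \<subseteq> {s. Re s > 0}"
    using path_image_rectpath_subset_cbox[OF a(1,2)] \<sigma> by (auto simp: in_cbox_complex_iff a)
  have hol: "perron_kern y holomorphic_on {s. Re s > 0}"
    unfolding perron_kern_def[abs_def] using y by (intro holomorphic_intros) (auto simp: add_eq_0_iff2)
  have "(perron_kern y has_contour_integral 0) (rectpath a1 a3)"
    by (rule Cauchy_theorem_convex_simple[OF hol]) (use img in \<open>auto simp: convex_halfspace_Re_gt\<close>)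
  then have tot: "contour_integral (rectpath a1 a3) (perron_kern y) = 0"
    by (rule contour_integral_unique)
  have seg: "closed_segment (Complex \<sigma> (- T)) (Complex \<sigma> T) \<subseteq> {s. Re s > 0}"
  proof
    fix s assume "s \<in> closed_segment (Complex \<sigma> (- T)) (Complex \<sigma> T)"
    from closed_segment_vertical[OF this] show "s \<in> {s. Re s > 0}" using \<sigma> by simp
  qed
  have "continuous_on (closed_segment (Complex \<sigma> (- T)) (Complex \<sigma> T)) (perron_kern y)"
    by (rule continuous_on_subset[OF holomorphic_on_imp_continuous_on[OF hol] seg])
  from contour_integral_reverse_linepath[OF this]
  have rev: "contour_integral (linepath (Complex \<sigma> T) (Complex \<sigma> (- T))) (perron_kern y) = - contour_integral (linepath (Complex \<sigma> (- T)) (Complex \<sigma> T)) (perron_kern y)"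
    by simp
  have split: "contour_integral (rectpath a1 a3) (perron_kern y) =
    contour_integral (linepath (Complex \<sigma> (- T)) (Complex (\<sigma> + T) (- T))) (perron_kern y) +
    contour_integral (linepath (Complex (\<sigma> + T) (- T)) (Complex (\<sigma> + T) T)) (perron_kern y) +
    contour_integral (linepath (Complex (\<sigma> + T) T) (Complex \<sigma> T)) (perron_kern y) +
    contour_integral (linepath (Complex \<sigma> T) (Complex \<sigma> (- T))) (perron_kern y)"
    unfolding a1_def[symmetric] a3_def[symmetric]
    using contour_integral_rectpath_split[OF a(1,2), of "perron_kern y"] continuous_on_subset[OF holomorphic_on_imp_continuous_on[OF hol] img]
    by (simp add: a)
  have mono: "y powr u \<le> y powr \<sigma>" if "\<sigma> \<le> u" for u using y that by (intro powr_mono') auto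
  have h1: "norm (contour_integral (linepath (Complex \<sigma> (- T)) (Complex (\<sigma> + T) (- T))) (perron_kern y)) \<le> 2 * y powr \<sigma> / T"
    using y T \<sigma> by (intro perron_kern_horizontal_bound mono) auto
  have h2: "norm (contour_integral (linepath (Complex (\<sigma> + T) T) (Complex \<sigma> T)) (perron_kern y)) \<le> 2 * y powr \<sigma> / T"
    using y T \<sigma> by (intro perron_kern_horizontal_bound mono) auto
  have h3: "norm (contour_integral (linepath (Complex (\<sigma> + T) (- T)) (Complex (\<sigma> + T) T)) (perron_kern y)) \<le> 4 * y powr \<sigma> / T"
    using y T \<sigma> by (intro perron_kern_vertical_bound mono) auto
  have tri: "norm b \<le> norm a + norm c + norm d" if "a + c + d + (- b) = 0" for a b c d :: complex
  proof -
    have "b = a + c + d" using that by simp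
    then show ?thesis using norm_triangle_ineq[of "a + c" d] norm_triangle_ineq[of a c] by simp
  qed
  from split have zero: "contour_integral (linepath (Complex \<sigma> (- T)) (Complex (\<sigma> + T) (- T))) (perron_kern y) +
    contour_integral (linepath (Complex (\<sigma> + T) (- T)) (Complex (\<sigma> + T) T)) (perron_kern y) +
    contour_integral (linepath (Complex (\<sigma> + T) T) (Complex \<sigma> T)) (perron_kern y) +
    - contour_integral (linepath (Complex \<sigma> (- T)) (Complex \<sigma> T)) (perron_kern y) = 0"
    unfolding tot rev by simp
  have sum8: "8 * u / T = 2 * u / T + 2 * u / T + 4 * u / T" for u
    by (simp flip: add_divide_distrib)
  show ?thesis using tri[OF zero] h1 h2 h3 sum8[of "y powr \<sigma>"] by linarith
qed

lemma perron:
  assumes y: "0 < y" and \<sigma>: "0 < \<sigma>" "\<sigma> \<le> 2" and T: "T \<ge> 2"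
  shows "norm (contour_integral (linepath (Complex \<sigma> (- T)) (Complex \<sigma> T)) (perron_kern y) - 2 * pi * \<i> * of_real (max 0 (1 - 1 / y)))
    \<le> 8 * y powr \<sigma> / T"
proof (cases "y \<ge> 1")
  case True
  then have "max 0 (1 - 1 / y) = 1 - 1 / y" by simp
  then show ?thesis using perron_ge_1[OF True \<sigma> T] by simp
next
  case False
  then have "max 0 (1 - 1 / y) = 0" using y by simp
  then show ?thesis using perron_lt_1[OF y _ \<sigma> T] False by simp
qed

section \<open>Riesz means from integrals along vertical lines\<close>

text \<open>The exponent is 1/2 from the Dirichlet series minus 2 from the kernel. Each half-line
  contributes at most 2, whatever \<open>T\<close> is.\<close>

lemma integral_three_halves_bound:
  assumes T: "T \<ge> (0::real)"
  shows "(\<lambda>t. (1 + \<bar>t\<bar>) powr (- 3/2)) integrable_on {-T..T}"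
    and "integral {-T..T} (\<lambda>t. (1 + \<bar>t\<bar>) powr (- 3/2)) \<le> 4"
proof -
  have "((\<lambda>t. (1 + \<bar>t\<bar>) powr (- 3/2)) has_integral (- 2 * (1 + T) powr (- 1/2) - (- 2 * (1 + 0) powr (- 1/2)))) {0..T}"
  proof (rule fundamental_theorem_of_calculus[OF T])
    fix t assume "t \<in> {0..T}"
    then show "((\<lambda>t. - 2 * (1 + t) powr (- 1/2)) has_vector_derivative (1 + \<bar>t\<bar>) powr (- 3/2)) (at t within {0..T})"
      unfolding has_real_derivative_iff_has_vector_derivative[symmetric]
      by (auto intro!: derivative_eq_intros)
  qed
  moreover have "((\<lambda>t. (1 + \<bar>t\<bar>) powr (- 3/2)) has_integral (2 * (1 - 0) powr (- 1/2) - 2 * (1 - (- T)) powr (- 1/2))) {-T..0}"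
  proof (rule fundamental_theorem_of_calculus)
    show "- T \<le> 0" using T by simp
    fix t assume "t \<in> {-T..0}"
    then show "((\<lambda>t. 2 * (1 - t) powr (- 1/2)) has_vector_derivative (1 + \<bar>t\<bar>) powr (- 3/2)) (at t within {-T..0})"
      unfolding has_real_derivative_iff_has_vector_derivative[symmetric]
      by (auto intro!: derivative_eq_intros)
  qed
  ultimately have *: "((\<lambda>t. (1 + \<bar>t\<bar>) powr (- 3/2)) has_integral
      ((2 * (1 - 0) powr (- 1/2) - 2 * (1 - (- T)) powr (- 1/2)) + (- 2 * (1 + T) powr (- 1/2) - (- 2 * (1 + 0) powr (- 1/2))))) {-T..T}"
    using T by (intro has_integral_combine[of "-T" 0 T]) auto
  then show "(\<lambda>t. (1 + \<bar>t\<bar>) powr (- 3/2)) integrable_on {-T..T}" by blast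
  show "integral {-T..T} (\<lambda>t. (1 + \<bar>t\<bar>) powr (- 3/2)) \<le> 4"
    unfolding integral_unique[OF *] by simp
qed

lemma dirichlet_line_integral_bound:
  assumes b: "dirichlet_conv b" and \<sigma>: "1 < \<sigma>" "\<sigma> \<le> 2" and x: "x > 0" and T: "T > 0"
    and C: "\<And>t. norm (dirichlet b (Complex \<sigma> t)) \<le> C * (1 + \<bar>t\<bar>) powr (1/2)"
  shows "norm (contour_integral (linepath (Complex \<sigma> (- T)) (Complex \<sigma> T)) (\<lambda>s. dirichlet b s * perron_kern x s)) \<le> 16 * C * x powr \<sigma>"
proof -
  define f where "f = (\<lambda>s. dirichlet b s * perron_kern x s)"
  have seg: "closed_segment (Complex \<sigma> (- T)) (Complex \<sigma> T) \<subseteq> {s. Re s > 1}"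
  proof
    fix s assume "s \<in> closed_segment (Complex \<sigma> (- T)) (Complex \<sigma> T)"
    from closed_segment_vertical[OF this] show "s \<in> {s. Re s > 1}" using \<sigma> by simp
  qed
  have cont: "continuous_on {s. Re s > 1} f"
    unfolding f_def using x
    by (intro continuous_on_mult perron_kern_continuous_on holomorphic_on_imp_continuous_on[OF dirichlet_holomorphic[OF b]]) auto
  have "f contour_integrable_on linepath (Complex \<sigma> (- T)) (Complex \<sigma> T)"
    by (intro contour_integrable_continuous_linepath continuous_on_subset[OF cont seg])
  then have "(f has_contour_integral contour_integral (linepath (Complex \<sigma> (- T)) (Complex \<sigma> T)) f) (linepath (Complex \<sigma> (- T)) (Complex \<sigma> T))"
    by (rule has_contour_integral_integral)
  then have hi: "((\<lambda>t. f (Complex \<sigma> t)) has_integral (- \<i> * contour_integral (linepath (Complex \<sigma> (- T)) (Complex \<sigma> T)) f)) {-T..T}"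
    using T by (subst (asm) has_contour_integral_linepath_same_Re_iff[of _ \<sigma> _ "-T" T]) auto
  have C0: "C \<ge> 0" using C[of 0] by (simp add: order_trans[OF norm_ge_zero])
  have bd: "norm (f (Complex \<sigma> t)) \<le> 4 * C * x powr \<sigma> * (1 + \<bar>t\<bar>) powr (- 3/2)" for t
  proof -
    \<comment> \<open>Both 1 and \<open>\<bar>t\<bar>\<close> are lower bounds for the modulus,
      hence so is their mean. Squaring the 2 gives the factor 4; the integral gives the other 4 of
      the constant 16.\<close>
    have ge: "(1 + \<bar>t\<bar>) / 2 \<le> norm s" if "Re s \<ge> 1" "Im s = t" for s
      using that abs_Re_le_cmod[of s] abs_Im_le_cmod[of s] by auto
    have "norm (perron_kern x (Complex \<sigma> t)) \<le> x powr \<sigma> / (((1 + \<bar>t\<bar>) / 2) * ((1 + \<bar>t\<bar>) / 2))"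
      using x \<sigma> by (intro norm_perron_kern_le ge) auto
    then have "norm (f (Complex \<sigma> t)) \<le> (C * (1 + \<bar>t\<bar>) powr (1/2)) * (x powr \<sigma> / (((1 + \<bar>t\<bar>) / 2) * ((1 + \<bar>t\<bar>) / 2)))"
      unfolding f_def norm_mult using C0 by (intro mult_mono C) auto
    also have "\<dots> = 4 * C * x powr \<sigma> * ((1 + \<bar>t\<bar>) powr (1/2) / (1 + \<bar>t\<bar>) powr 2)"
      by (simp add: power2_eq_square)
    also have "(1 + \<bar>t\<bar>) powr (1/2) / (1 + \<bar>t\<bar>) powr 2 = (1 + \<bar>t\<bar>) powr (- 3/2)"
      using powr_diff[of "1 + \<bar>t\<bar>" "1/2" 2] by simp
    finally show ?thesis .
  qed
  have gi: "(\<lambda>t. 4 * C * x powr \<sigma> * (1 + \<bar>t\<bar>) powr (- 3/2)) integrable_on {-T..T}"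
    by (intro integrable_on_mult_right integral_three_halves_bound) (use T in auto)
  have "norm (- \<i> * contour_integral (linepath (Complex \<sigma> (- T)) (Complex \<sigma> T)) f) = norm (integral {-T..T} (\<lambda>t. f (Complex \<sigma> t)))"
    using integral_unique[OF hi] by simp
  also have "\<dots> \<le> integral {-T..T} (\<lambda>t. 4 * C * x powr \<sigma> * (1 + \<bar>t\<bar>) powr (- 3/2))"
    using hi by (intro integral_norm_bound_integral bd gi) (auto simp: has_integral_iff)
  also have "\<dots> = 4 * C * x powr \<sigma> * integral {-T..T} (\<lambda>t. (1 + \<bar>t\<bar>) powr (- 3/2))"
    by simp
  also have "\<dots> \<le> 4 * C * x powr \<sigma> * 4"
    using T C0 by (intro mult_left_mono integral_three_halves_bound) auto
  finally show ?thesis by (simp add: norm_mult f_def)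
qed

text \<open>For \<open>n = 0\<close> both sides are 0, because \<open>x / 0 = 0\<close> and
  \<open>0 powr s = 0\<close>; series can therefore run over all \<open>n\<close>.\<close>

lemma perron_kern_divide_nat:
  assumes "x > 0"
  shows "perron_kern (x / real n) s = of_nat n powr (- s) * perron_kern x s"
proof (cases "n = 0")
  case False
  have "(of_real x :: complex) = of_real (x / real n) * of_nat n" using False by simp
  also have "\<dots> powr s = of_real (x / real n) powr s * of_nat n powr s"
    using assms by (intro powr_times_real) auto
  finally have "(of_real (x / real n) :: complex) powr s = of_nat n powr (- s) * of_real x powr s"
    using False by (simp add: powr_minus)
  then show ?thesis by (simp add: perron_kern_def)
qed (simp add: perron_kern_def)

text \<open>On the line the kernel at \<open>x / n\<close> is at most
  \<open>x powr \<sigma> * n powr (- \<sigma>)\<close> in modulus, so the series converges uniformly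
  and may be integrated term by term over the finite segment.\<close>

lemma dirichlet_line_integral_sums:
  assumes b: "dirichlet_conv b" and \<sigma>: "1 < \<sigma>" and x: "x > 0" and T: "T > 0"
  shows "(\<lambda>n. of_real (b n) * contour_integral (linepath (Complex \<sigma> (- T)) (Complex \<sigma> T)) (perron_kern (x / real n))) sums
     contour_integral (linepath (Complex \<sigma> (- T)) (Complex \<sigma> T)) (\<lambda>s. dirichlet b s * perron_kern x s)"
proof -
  define \<gamma> where "\<gamma> = linepath (Complex \<sigma> (- T)) (Complex \<sigma> T)"
  have img: "Re s = \<sigma>" if "s \<in> path_image \<gamma>" for s
    using closed_segment_vertical[of s \<sigma> "-T" T] that by (simp add: \<gamma>_def)
  have cont: "continuous_on (path_image \<gamma>) (perron_kern (x / real n))" for n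
  proof (cases "n = 0")
    case False
    then show ?thesis using x img \<sigma> by (intro perron_kern_continuous_on) force+
  qed (simp add: perron_kern_def[abs_def])
  have int: "perron_kern (x / real n) contour_integrable_on \<gamma>" for n
    using cont[of n] unfolding \<gamma>_def by (intro contour_integrable_continuous_linepath) simp
  have kx: "norm (perron_kern x s) \<le> x powr \<sigma>" if "s \<in> path_image \<gamma>" for s
  proof -
    have "norm (perron_kern x s) \<le> x powr \<sigma> / (1 * 1)"
      using x \<sigma> img[OF that] abs_Re_le_cmod[of s] abs_Re_le_cmod[of "s + 1"] by (intro norm_perron_kern_le) auto
    then show ?thesis by simp
  qed
  have ul: "uniform_limit (path_image \<gamma>) (\<lambda>N s. \<Sum>n<N. of_real (b n) * perron_kern (x / real n) s) (\<lambda>s. \<Sum>n. of_real (b n) * perron_kern (x / real n) s) sequentially"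
  proof (rule Weierstrass_m_test)
    show "summable (\<lambda>n. \<bar>b n\<bar> * real n powr (- \<sigma>) * x powr \<sigma>)"
      using b \<sigma> by (intro summable_mult2) (auto simp: dirichlet_conv_def)
    fix n s assume s: "s \<in> path_image \<gamma>"
    have "norm (of_real (b n) * perron_kern (x / real n) s) = \<bar>b n\<bar> * real n powr (- \<sigma>) * norm (perron_kern x s)"
      using x img[OF s] by (simp add: perron_kern_divide_nat norm_mult norm_nat_powr)
    also have "\<dots> \<le> \<bar>b n\<bar> * real n powr (- \<sigma>) * x powr \<sigma>"
      by (intro mult_left_mono kx s) auto
    finally show "norm (of_real (b n) * perron_kern (x / real n) s) \<le> \<bar>b n\<bar> * real n powr (- \<sigma>) * x powr \<sigma>" .
  qed
  have lim: "(\<lambda>N. contour_integral \<gamma> (\<lambda>s. \<Sum>n<N. of_real (b n) * perron_kern (x / real n) s)) \<longlonglongrightarrow>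
      contour_integral \<gamma> (\<lambda>s. \<Sum>n. of_real (b n) * perron_kern (x / real n) s)"
  proof (rule contour_integral_uniform_limit(2)[OF _ ul])
    show "\<forall>\<^sub>F N in sequentially. (\<lambda>s. \<Sum>n<N. of_real (b n) * perron_kern (x / real n) s) contour_integrable_on \<gamma>"
      by (intro always_eventually allI contour_integrable_sum contour_integrable_lmul int) auto
    show "norm (vector_derivative \<gamma> (at t)) \<le> norm (Complex \<sigma> T - Complex \<sigma> (- T))" for t
      by (simp add: \<gamma>_def)
  qed (auto simp: \<gamma>_def)
  have "contour_integral \<gamma> (\<lambda>s. \<Sum>n<N. of_real (b n) * perron_kern (x / real n) s) = (\<Sum>n<N. of_real (b n) * contour_integral \<gamma> (perron_kern (x / real n)))" for N
    by (subst contour_integral_sum) (auto intro: contour_integrable_lmul int simp: contour_integral_lmul[OF int])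
  with lim have lim': "(\<lambda>n. of_real (b n) * contour_integral \<gamma> (perron_kern (x / real n))) sums contour_integral \<gamma> (\<lambda>s. \<Sum>n. of_real (b n) * perron_kern (x / real n) s)"
    by (simp add: sums_def)
  have "contour_integral \<gamma> (\<lambda>s. \<Sum>n. of_real (b n) * perron_kern (x / real n) s) = contour_integral \<gamma> (\<lambda>s. dirichlet b s * perron_kern x s)"
  proof (rule contour_integral_eq)
    fix s assume s: "s \<in> path_image \<gamma>"
    have "(\<Sum>n. of_real (b n) * perron_kern (x / real n) s) = (\<Sum>n. (of_real (b n) * of_nat n powr (- s)) * perron_kern x s)"
      using x by (simp add: perron_kern_divide_nat mult_ac)
    also have "\<dots> = dirichlet b s * perron_kern x s"
      unfolding dirichlet_def using b img[OF s] \<sigma> by (intro suminf_mult2[symmetric] dirichlet_conv_summable) auto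
    finally show "(\<Sum>n. of_real (b n) * perron_kern (x / real n) s) = dirichlet b s * perron_kern x s" .
  qed
  with lim' show ?thesis by (simp add: \<gamma>_def)
qed

text \<open>On the line \<open>Re s = 1 + 1 / ln x\<close> the modulus of \<open>x powr s\<close> is only \<open>exp 1 * x\<close>.\<close>

lemma riesz_mean_bound:
  assumes b: "dirichlet_conv b" "b 0 = 0" and x: "x \<ge> 3"
    and C: "\<And>s. 1 < Re s \<Longrightarrow> Re s \<le> 2 \<Longrightarrow> norm (dirichlet b s) \<le> C * (1 + \<bar>Im s\<bar>) powr (1/2)"
  shows "\<bar>\<Sum>n\<le>nat \<lfloor>x\<rfloor>. b n * (x - real n)\<bar> \<le> 16 * C * x\<^sup>2"
proof -
  have x0: "x > 0" using x by simp
  have "exp 1 \<le> x" using x exp_le by linarith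
  then have lnx: "ln x \<ge> 1" using x by (subst ln_ge_iff) auto
  define \<sigma> where "\<sigma> = 1 + 1 / ln x"
  have \<sigma>: "1 < \<sigma>" "\<sigma> \<le> 2" using lnx by (auto simp: \<sigma>_def)
  have "x powr \<sigma> = x * x powr (1 / ln x)" using x by (simp add: \<sigma>_def powr_add)
  also have "x powr (1 / ln x) = exp 1" using x lnx by (simp add: powr_def)
  finally have x\<sigma>: "x powr \<sigma> \<le> 3 * x" using x exp_le by simp
  define S where "S = (\<Sum>n\<le>nat \<lfloor>x\<rfloor>. b n * (1 - real n / x))"
  define K where "K = (\<Sum>n. \<bar>b n\<bar> * real n powr (- \<sigma>))"
  have smK: "summable (\<lambda>n. \<bar>b n\<bar> * real n powr (- \<sigma>))" using b \<sigma> by (auto simp: dirichlet_conv_def)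
  have S: "(\<lambda>n. of_real (b n * max 0 (1 - real n / x))) sums (of_real S :: complex)"
  proof -
    have "(\<lambda>n. b n * max 0 (1 - real n / x)) sums (\<Sum>n\<le>nat \<lfloor>x\<rfloor>. b n * max 0 (1 - real n / x))"
    proof (rule sums_finite)
      fix n assume "n \<notin> {..nat \<lfloor>x\<rfloor>}"
      then have "real n > x" using x by (auto simp: not_le) linarith
      then show "b n * max 0 (1 - real n / x) = 0" using x0 by (simp add: field_simps)
    qed auto
    also have "(\<Sum>n\<le>nat \<lfloor>x\<rfloor>. b n * max 0 (1 - real n / x)) = S"
      unfolding S_def
    proof (rule sum.cong)
      fix n assume "n \<in> {..nat \<lfloor>x\<rfloor>}"
      then have "real n \<le> x" using x by (auto simp: le_nat_floor) linarith
      then show "b n * max 0 (1 - real n / x) = b n * (1 - real n / x)" using x0 by (simp add: field_simps)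
    qed auto
    finally show ?thesis by (simp only: sums_of_real_iff)
  qed
  have main: "norm (2 * pi * \<i> * of_real S) \<le> 16 * C * x powr \<sigma> + 8 * x powr \<sigma> * K / T" if T: "T \<ge> 2" for T
  proof -
    define I where "I = (\<lambda>n. contour_integral (linepath (Complex \<sigma> (- T)) (Complex \<sigma> T)) (perron_kern (x / real n)))"
    define J where "J = contour_integral (linepath (Complex \<sigma> (- T)) (Complex \<sigma> T)) (\<lambda>s. dirichlet b s * perron_kern x s)"
    have "norm J \<le> 16 * C * x powr \<sigma>"
      unfolding J_def using T x0 \<sigma> b C[of "Complex \<sigma> _"] by (intro dirichlet_line_integral_bound) auto
    have sJ: "(\<lambda>n. of_real (b n) * I n) sums J"
      unfolding J_def I_def using T x0 \<sigma> b by (intro dirichlet_line_integral_sums) auto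
    have sD: "(\<lambda>n. of_real (b n) * I n - 2 * pi * \<i> * of_real (b n * max 0 (1 - real n / x))) sums (J - 2 * pi * \<i> * of_real S)"
      by (intro sums_diff sums_mult S sJ)
    have le: "norm (of_real (b n) * I n - 2 * pi * \<i> * of_real (b n * max 0 (1 - real n / x))) \<le> 8 * x powr \<sigma> / T * (\<bar>b n\<bar> * real n powr (- \<sigma>))" for n
    proof (cases "n = 0")
      \<comment> \<open>The Riesz sum sees the coefficient at 0 while the Dirichlet series does not;
        hence the assumption \<open>b 0 = 0\<close>.\<close>
      case True
      then show ?thesis using b by simp
    next
      case False
      have "of_real (b n) * I n - 2 * pi * \<i> * of_real (b n * max 0 (1 - real n / x)) = of_real (b n) * (I n - 2 * pi * \<i> * of_real (max 0 (1 - 1 / (x / real n))))"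
        by (simp add: algebra_simps)
      also have "norm \<dots> \<le> \<bar>b n\<bar> * (8 * (x / real n) powr \<sigma> / T)"
        unfolding norm_mult norm_of_real I_def using False x0 \<sigma> T by (intro mult_left_mono perron) auto
      also have "(x / real n) powr \<sigma> = x powr \<sigma> * real n powr (- \<sigma>)"
        using x0 False by (simp add: powr_divide powr_minus field_simps)
      finally show ?thesis by (simp add: mult_ac)
    qed
    have "norm (J - 2 * pi * \<i> * of_real S) \<le> (\<Sum>n. 8 * x powr \<sigma> / T * (\<bar>b n\<bar> * real n powr (- \<sigma>)))"
      unfolding sums_unique[OF sD] by (intro norm_suminf_le le summable_mult smK)
    also have "\<dots> = 8 * x powr \<sigma> * K / T" unfolding K_def using smK by (subst suminf_mult) auto
    finally show ?thesis
      using \<open>norm J \<le> _\<close> norm_triangle_ineq2[of "2 * pi * \<i> * of_real S" J] by (simp add: norm_minus_commute)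
  qed
  \<comment> \<open>Here \<open>x\<close>, and with it \<open>\<sigma>\<close> and \<open>K\<close>,
    is fixed while \<open>T\<close> grows. The truncation error vanishes, so no bound for
    \<open>K\<close> in terms of \<open>x\<close> is called for.\<close>
  have "norm (2 * pi * \<i> * of_real S) \<le> 16 * C * x powr \<sigma> + 0"
  proof (rule tendsto_lowerbound)
    show "((\<lambda>T. 16 * C * x powr \<sigma> + 8 * x powr \<sigma> * K / T) \<longlongrightarrow> 16 * C * x powr \<sigma> + 0) at_top"
      by (intro tendsto_add tendsto_const real_tendsto_divide_at_top[OF tendsto_const filterlim_ident])
    show "\<forall>\<^sub>F T in at_top. norm (2 * pi * \<i> * of_real S) \<le> 16 * C * x powr \<sigma> + 8 * x powr \<sigma> * K / T"
      using eventually_ge_at_top[of 2] by eventually_elim (rule main)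
  qed auto
  then have *: "2 * pi * \<bar>S\<bar> \<le> 16 * C * x powr \<sigma>" by (simp add: norm_mult)
  have C0: "C \<ge> 0" using C[of 2] by (simp add: order_trans[OF norm_ge_zero])
  have "2 * pi * \<bar>S\<bar> \<le> 16 * C * (3 * x)"
    by (rule order_trans[OF *]) (use mult_left_mono[OF x\<sigma>, of "16 * C"] C0 in simp)
  \<comment> \<open>The 3 from \<open>exp 1 \<le> 3\<close> is absorbed by the factor
    \<open>2 * pi\<close>.\<close>
  moreover have "3 * \<bar>S\<bar> \<le> 2 * pi * \<bar>S\<bar>" using pi_gt3 by (intro mult_right_mono) auto
  ultimately have "\<bar>S\<bar> \<le> 16 * C * x" by simp
  moreover have "(\<Sum>n\<le>nat \<lfloor>x\<rfloor>. b n * (x - real n)) = x * S"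
    unfolding S_def sum_distrib_left using x0 by (intro sum.cong) (auto simp: field_simps)
  ultimately show ?thesis using x0 by (simp add: abs_mult power2_eq_square mult_left_mono mult_ac)
qed

section \<open>The prime number theorem with error term\<close>

definition partial_sum :: "(nat \<Rightarrow> real) \<Rightarrow> real \<Rightarrow> real" where
  "partial_sum a x = (\<Sum>n\<le>nat \<lfloor>x\<rfloor>. a n)"

text \<open>For \<open>x \<ge> 0\<close> this is the integral of \<open>partial_sum a\<close> over
  \<open>[0, x]\<close>.\<close>

definition riesz_sum :: "(nat \<Rightarrow> real) \<Rightarrow> real \<Rightarrow> real" where
  "riesz_sum a x = (\<Sum>n\<le>nat \<lfloor>x\<rfloor>. a n * (x - real n))"

lemma sum_atMost_floor_split:
  assumes "0 \<le> x" "0 \<le> h"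
  shows "(\<Sum>n\<le>nat \<lfloor>x + h\<rfloor>. f n) = (\<Sum>n\<le>nat \<lfloor>x\<rfloor>. f n) + (\<Sum>n\<in>{nat \<lfloor>x\<rfloor><..nat \<lfloor>x + h\<rfloor>}. f n :: real)"
proof -
  have "nat \<lfloor>x\<rfloor> \<le> nat \<lfloor>x + h\<rfloor>" using assms by (intro nat_mono floor_mono) auto
  then have "{..nat \<lfloor>x + h\<rfloor>} = {..nat \<lfloor>x\<rfloor>} \<union> {nat \<lfloor>x\<rfloor><..nat \<lfloor>x + h\<rfloor>}" by auto
  then show ?thesis by (simp only:) (subst sum.union_disjoint, auto)
qed

lemma in_floor_interval:
  assumes "0 \<le> x" "0 \<le> h" "n \<in> {nat \<lfloor>x\<rfloor><..nat \<lfloor>x + h\<rfloor>}"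
  shows "x < real n" "real n \<le> x + h"
  using assms by (auto simp: nat_less_iff le_nat_iff less_floor_iff floor_less_iff le_floor_iff)

text \<open>With nonnegative coefficients the partial sums increase, so the increment of their
  integral over a step of length \<open>h\<close> lies between \<open>h\<close> times their values
  at the two ends.\<close>

lemma riesz_sum_diff:
  assumes a: "\<And>n. a n \<ge> 0" and x: "0 \<le> x" and h: "0 \<le> h"
  shows "h * partial_sum a x \<le> riesz_sum a (x + h) - riesz_sum a x" "riesz_sum a (x + h) - riesz_sum a x \<le> h * partial_sum a (x + h)"
proof -
  define D where "D = {nat \<lfloor>x\<rfloor><..nat \<lfloor>x + h\<rfloor>}"
  have "riesz_sum a (x + h) = (\<Sum>n\<le>nat \<lfloor>x\<rfloor>. a n * (x + h - real n)) + (\<Sum>n\<in>D. a n * (x + h - real n))"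
    unfolding riesz_sum_def D_def using x h by (rule sum_atMost_floor_split)
  moreover have "(\<Sum>n\<le>nat \<lfloor>x\<rfloor>. a n * (x + h - real n)) = riesz_sum a x + h * partial_sum a x"
    unfolding riesz_sum_def partial_sum_def sum_distrib_left sum.distrib[symmetric]
    by (intro sum.cong) (auto simp: algebra_simps)
  ultimately have eq: "riesz_sum a (x + h) - riesz_sum a x = h * partial_sum a x + (\<Sum>n\<in>D. a n * (x + h - real n))" by simp
  have "(\<Sum>n\<in>D. a n * (x + h - real n)) \<ge> 0"
    using in_floor_interval[OF x h] a by (intro sum_nonneg mult_nonneg_nonneg) (auto simp: D_def)
  then show "h * partial_sum a x \<le> riesz_sum a (x + h) - riesz_sum a x" using eq by simp
  have "(\<Sum>n\<in>D. a n * (x + h - real n)) \<le> (\<Sum>n\<in>D. a n * h)"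
  proof (intro sum_mono mult_left_mono a)
    fix n assume "n \<in> D"
    then show "x + h - real n \<le> h" using in_floor_interval(1)[OF x h, of n] by (simp add: D_def)
  qed
  also have "\<dots> = h * (\<Sum>n\<in>D. a n)" by (simp add: sum_distrib_left mult.commute)
  finally show "riesz_sum a (x + h) - riesz_sum a x \<le> h * partial_sum a (x + h)"
    unfolding eq partial_sum_def sum_atMost_floor_split[OF x h] D_def by (simp add: distrib_left)
qed

text \<open>Kept apart from \<open>ln_power\<close>: differencing uses monotone partial sums, which
  each sequence has but their difference lacks.\<close>

definition ln_mangoldt :: "nat \<Rightarrow> nat \<Rightarrow> real" where
  "ln_mangoldt k n = ln (real n) ^ k * mangoldt n"

text \<open>The value at \<open>0\<close> has to be set separately because \<open>ln 0 ^ 0 = 1\<close>.\<close>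

definition ln_power :: "nat \<Rightarrow> nat \<Rightarrow> real" where
  "ln_power k n = (if n = 0 then 0 else ln (real n) ^ k)"

lemma ln_mangoldt_nonneg: "ln_mangoldt k n \<ge> 0"
  by (cases "n = 0") (auto simp: ln_mangoldt_def mangoldt_nonneg)

lemma ln_power_nonneg: "ln_power k n \<ge> 0"
  by (auto simp: ln_power_def)

lemma riesz_mangoldt:
  obtains K where "K > 0" "\<And>x. x \<ge> 3 \<Longrightarrow> \<bar>riesz_sum (ln_mangoldt k) x - riesz_sum (ln_power k) x\<bar> \<le> K * x\<^sup>2"
proof -
  obtain C where C: "C > 0" "\<And>s. 1 < Re s \<Longrightarrow> Re s \<le> 2 \<Longrightarrow>
      norm (dirichlet (\<lambda>n. ln (real n) ^ k * (mangoldt n - 1)) s) \<le> C * (1 + \<bar>Im s\<bar>) powr (1/2)"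
    by (rule dirichlet_mangoldt_bound) (rule that, assumption, blast)
  define b where "b = (\<lambda>n. ln_mangoldt k n - ln_power k n)"
  \<comment> \<open>Positive \<open>n\<close> only: for \<open>k = 0\<close> the right-hand side
    would be -1 at index 0, where \<open>b\<close> is 0. The series does not see that index.\<close>
  have b: "b n = ln (real n) ^ k * (mangoldt n - 1)" if "n > 0" for n
    using that by (simp add: b_def ln_mangoldt_def ln_power_def algebra_simps)
  have dc: "dirichlet_conv b"
    by (rule dirichlet_conv_mono[OF dirichlet_conv_ln_power[OF dirichlet_conv_diff[OF dirichlet_conv_mangoldt dirichlet_conv_one], of k]]) (simp add: b)
  have eq: "dirichlet b s = dirichlet (\<lambda>n. ln (real n) ^ k * (mangoldt n - 1)) s" for s
    unfolding dirichlet_def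
  proof (rule suminf_cong)
    show "of_real (b n) * of_nat n powr (- s) = complex_of_real (ln (real n) ^ k * (mangoldt n - 1)) * of_nat n powr (- s)" for n
      by (cases "n = 0") (auto simp: b)
  qed
  show ?thesis
  proof (rule that)
    show "16 * C > 0" using C by simp
    fix x :: real assume x: "x \<ge> 3"
    have "\<bar>\<Sum>n\<le>nat \<lfloor>x\<rfloor>. b n * (x - real n)\<bar> \<le> 16 * C * x\<^sup>2"
    proof (rule riesz_mean_bound[OF dc _ x])
      show "b 0 = 0" by (simp add: b_def ln_mangoldt_def ln_power_def)
    qed (simp add: eq C)
    also have "(\<Sum>n\<le>nat \<lfloor>x\<rfloor>. b n * (x - real n)) = riesz_sum (ln_mangoldt k) x - riesz_sum (ln_power k) x"
      by (simp add: riesz_sum_def b_def left_diff_distrib sum_subtractf)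
    finally show "\<bar>riesz_sum (ln_mangoldt k) x - riesz_sum (ln_power k) x\<bar> \<le> 16 * C * x\<^sup>2" .
  qed
qed

lemma partial_sum_ln_power_diff:
  assumes x: "0 \<le> x" and h: "0 \<le> h"
  shows "partial_sum (ln_power k) (x + h) - partial_sum (ln_power k) x \<le> (h + 1) * \<bar>ln (x + h)\<bar> ^ k"
proof -
  define D where "D = {nat \<lfloor>x\<rfloor><..nat \<lfloor>x + h\<rfloor>}"
  have "partial_sum (ln_power k) (x + h) - partial_sum (ln_power k) x = (\<Sum>n\<in>D. ln_power k n)"
    unfolding partial_sum_def sum_atMost_floor_split[OF x h] D_def by simp
  also have "\<dots> \<le> (\<Sum>n\<in>D. \<bar>ln (x + h)\<bar> ^ k)"
  proof (rule sum_mono)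
    fix n assume n: "n \<in> D"
    then have "n \<ge> 1" by (auto simp: D_def)
    moreover have "ln (real n) \<le> ln (x + h)"
      using in_floor_interval(2)[OF x h, of n] n \<open>n \<ge> 1\<close> by (subst ln_le_cancel_iff) (auto simp: D_def)
    ultimately show "ln_power k n \<le> \<bar>ln (x + h)\<bar> ^ k" by (auto simp: ln_power_def intro!: power_mono)
  qed
  also have "\<dots> = real (card D) * \<bar>ln (x + h)\<bar> ^ k" by simp
  also have "\<dots> \<le> (h + 1) * \<bar>ln (x + h)\<bar> ^ k"
  proof (rule mult_right_mono)
    have "nat \<lfloor>x\<rfloor> \<le> nat \<lfloor>x + h\<rfloor>" using x h by (intro nat_mono floor_mono) auto
    then have "real (card D) = real_of_int \<lfloor>x + h\<rfloor> - real_of_int \<lfloor>x\<rfloor>"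
      using x h by (simp add: D_def of_nat_diff)
    also have "\<dots> \<le> h + 1" by linarith
    finally show "real (card D) \<le> h + 1" .
  qed auto
  finally show ?thesis .
qed

text \<open>The \<open>m\<close>-th power of \<open>ln x \<le> m * x powr (1 / m)\<close>. It serves
  to absorb bounded terms into multiples of \<open>x / ln x ^ m\<close>.\<close>

lemma ln_power_le:
  assumes "x \<ge> 1" "m > 0"
  shows "ln x ^ m \<le> real m ^ m * x"
proof -
  have "ln x \<le> x powr (1 / real m) / (1 / real m)"
    using assms by (intro ln_powr_bound) auto
  then have "ln x ^ m \<le> (real m * x powr (1 / real m)) ^ m"
    using assms by (intro power_mono) (auto simp: mult.commute)
  also have "\<dots> = real m ^ m * (x powr (1 / real m)) ^ m" by (simp add: power_mult_distrib)
  also have "(x powr (1 / real m)) ^ m = x"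
    using assms by (simp add: powr_powr flip: powr_realpow)
  finally show ?thesis .
qed

text \<open>Origin of the threshold 8 in what follows: \<open>8 = 2 ^ 3\<close> and
  \<open>ln 2 \<ge> 2/3\<close>.\<close>

lemma ln_ge_2: "x \<ge> 8 \<Longrightarrow> ln (x :: real) \<ge> 2"
proof -
  assume x: "x \<ge> 8"
  have "2 \<le> 3 * ln (2 :: real)" using ln2_ge_two_thirds by simp
  also have "3 * ln (2 :: real) = ln (2 ^ 3)" by (subst ln_realpow) auto
  also have "\<dots> \<le> ln x" using x by (subst ln_le_cancel_iff) auto
  finally show ?thesis .
qed

text \<open>Differencing the Riesz means over steps of length \<open>h = x / ln x ^ m\<close> costs \<open>x\<^sup>2 / h\<close> from the bound on the means and
\<open>h ln x ^ (2 m)\<close> from the growth of the second sum; both are of order \<open>x ln x ^ m\<close>.\<close>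

lemma partial_sum_diff_bound:
  assumes m: "m > 0"
  obtains A where "A > 0" "\<And>x. x \<ge> 8 \<Longrightarrow> \<bar>partial_sum (ln_mangoldt (2 * m)) x - partial_sum (ln_power (2 * m)) x\<bar> \<le> A * x * ln x ^ m"
proof -
  obtain K where K: "K > 0" "\<And>x. x \<ge> 3 \<Longrightarrow> \<bar>riesz_sum (ln_mangoldt (2 * m)) x - riesz_sum (ln_power (2 * m)) x\<bar> \<le> K * x\<^sup>2"
    by (rule riesz_mangoldt) (rule that, assumption, blast)
  show ?thesis
  proof (rule that)
    show "(1 + real m ^ m) * 4 ^ m + 4 * K > 0" using K by (simp add: add_nonneg_pos)
    fix x :: real assume x: "x \<ge> 8"
    define L where "L = ln x"
    have L: "L \<ge> 2" unfolding L_def using x by (rule ln_ge_2)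
    have Lm: "L ^ m \<ge> 2"
    proof -
      have "2 \<le> (2::real) ^ m" using m power_increasing[of 1 m "2::real"] by simp
      also have "\<dots> \<le> L ^ m" using L by (intro power_mono) auto
      finally show ?thesis .
    qed
    define h where "h = x / L ^ m"
    have "x / L ^ m \<le> x / 2" using x Lm by (intro divide_left_mono) auto
    \<comment> \<open>Thus \<open>x - h\<close> and \<open>x + h\<close> stay between
      \<open>x / 2 \<ge> 4\<close> and \<open>3/2 * x\<close>, where the bound for the Riesz means
      applies.\<close>
    then have h: "h > 0" "h \<le> x / 2" using x Lm by (auto simp: h_def)
    define U V where "U = partial_sum (ln_mangoldt (2 * m))" and "V = partial_sum (ln_power (2 * m))"
    define U1 V1 where "U1 = riesz_sum (ln_mangoldt (2 * m))" and "V1 = riesz_sum (ln_power (2 * m))"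
    have K': "\<bar>U1 z - V1 z\<bar> \<le> K * (9/4 * x\<^sup>2)" if "3 \<le> z" "z \<le> 3/2 * x" for z
    proof -
      have "\<bar>U1 z - V1 z\<bar> \<le> K * z\<^sup>2" unfolding U1_def V1_def using that by (intro K) auto
      also have "z\<^sup>2 \<le> (3/2 * x)\<^sup>2" using that by (intro power_mono) auto
      finally show ?thesis using K by (simp add: power2_eq_square)
    qed
    have K1: "\<bar>U1 x - V1 x\<bar> \<le> K * x\<^sup>2" unfolding U1_def V1_def using x by (intro K) auto
    have lnle: "\<bar>ln z\<bar> ^ (2 * m) \<le> 4 ^ m * L ^ (2 * m)" if "x \<le> z" "z \<le> 3/2 * x" for z
    proof -
      have "z \<le> x * x" using that x by (intro order_trans[OF that(2)] mult_right_mono) auto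
      then have "ln z \<le> ln (x * x)" using that x by (subst ln_le_cancel_iff) auto
      also have "\<dots> = 2 * L" using x by (simp add: L_def ln_mult)
      finally have "\<bar>ln z\<bar> \<le> 2 * L" using that x by simp
      then have "\<bar>ln z\<bar> ^ (2 * m) \<le> (2 * L) ^ (2 * m)" by (intro power_mono) auto
      also have "\<dots> = 4 ^ m * L ^ (2 * m)" by (simp add: power_mult_distrib power_mult)
      finally show ?thesis .
    qed
    define E where "E = (h + 1) * (4 ^ m * L ^ (2 * m))"
    have V_up: "V (x + h) - V x \<le> E"
    proof -
      have "V (x + h) - V x \<le> (h + 1) * \<bar>ln (x + h)\<bar> ^ (2 * m)"
        unfolding V_def using x h by (intro partial_sum_ln_power_diff) auto
      also have "\<dots> \<le> E" unfolding E_def using x h by (intro mult_left_mono lnle) auto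
      finally show ?thesis .
    qed
    have V_low: "V x - V (x - h) \<le> E"
    proof -
      have "V ((x - h) + h) - V (x - h) \<le> (h + 1) * \<bar>ln ((x - h) + h)\<bar> ^ (2 * m)"
        unfolding V_def using x h by (intro partial_sum_ln_power_diff) auto
      also have "\<dots> \<le> E" unfolding E_def using x h by (intro mult_left_mono lnle) auto
      finally show ?thesis by simp
    qed
    \<comment> \<open>The Riesz means are compared at two points, at a cost of
      \<open>1 + 9/4 \<le> 4\<close> times \<open>K * x\<^sup>2\<close>.\<close>
    have up: "h * U x \<le> h * V (x + h) + 4 * K * x\<^sup>2"
    proof -
      have "h * U x \<le> U1 (x + h) - U1 x"
        unfolding U_def U1_def using x h by (intro riesz_sum_diff ln_mangoldt_nonneg) auto
      moreover have "V1 (x + h) - V1 x \<le> h * V (x + h)"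
        unfolding V_def V1_def using x h by (intro riesz_sum_diff ln_power_nonneg) auto
      moreover have "\<bar>U1 (x + h) - V1 (x + h)\<bar> \<le> K * (9/4 * x\<^sup>2)" using x h by (intro K') auto
      moreover have "0 \<le> K * x\<^sup>2" using K by simp
      ultimately show ?thesis using K1 by linarith
    qed
    have low: "h * V (x - h) - 4 * K * x\<^sup>2 \<le> h * U x"
    proof -
      have "U1 (x - h + h) - U1 (x - h) \<le> h * U (x - h + h)"
        unfolding U_def U1_def using x h by (intro riesz_sum_diff ln_mangoldt_nonneg) auto
      moreover have "h * V (x - h) \<le> V1 (x - h + h) - V1 (x - h)"
        unfolding V_def V1_def using x h by (intro riesz_sum_diff ln_power_nonneg) auto
      moreover have "\<bar>U1 (x - h) - V1 (x - h)\<bar> \<le> K * (9/4 * x\<^sup>2)" using x h by (intro K') auto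
      moreover have "0 \<le> K * x\<^sup>2" using K by simp
      ultimately show ?thesis using K1 unfolding diff_add_cancel by linarith
    qed
    have "h * (U x - V x) \<le> h * E + 4 * K * x\<^sup>2"
      using up mult_left_mono[OF V_up, of h] h by (simp add: right_diff_distrib)
    moreover have "h * (V x - U x) \<le> h * E + 4 * K * x\<^sup>2"
      using low mult_left_mono[OF V_low, of h] h by (simp add: right_diff_distrib)
    ultimately have "h * \<bar>U x - V x\<bar> \<le> h * E + 4 * K * x\<^sup>2" by (simp add: abs_if)
    then have "\<bar>U x - V x\<bar> \<le> E + 4 * K * x\<^sup>2 / h" using h by (simp add: field_simps)
    also have "4 * K * x\<^sup>2 / h = 4 * K * x * L ^ m" using x Lm by (simp add: h_def power2_eq_square)
    also have "E \<le> (1 + real m ^ m) * 4 ^ m * x * L ^ m"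
    proof -
      \<comment> \<open>This absorbs the additive 1 in \<open>h + 1\<close>, the rounding loss in
        counting integers in a step.\<close>
      have "1 \<le> real m ^ m * x / L ^ m" using ln_power_le[of x m] x m Lm by (simp add: L_def)
      then have "h + 1 \<le> (1 + real m ^ m) * x / L ^ m" by (simp add: h_def add_divide_distrib distrib_right)
      then have "E \<le> (1 + real m ^ m) * x / L ^ m * (4 ^ m * L ^ (2 * m))"
        unfolding E_def by (intro mult_right_mono) auto
      also have "L ^ (2 * m) = L ^ m * L ^ m" by (simp add: mult_2 power_add)
      finally show ?thesis using L by (simp add: mult_ac)
    qed
    finally show "\<bar>partial_sum (ln_mangoldt (2 * m)) x - partial_sum (ln_power (2 * m)) x\<bar> \<le> ((1 + real m ^ m) * 4 ^ m + 4 * K) * x * ln x ^ m"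
      by (simp add: U_def V_def L_def algebra_simps)
  qed
qed

section \<open>Removing the logarithmic weights\<close>

lemma abel_summation:
  fixes b f :: "nat \<Rightarrow> real"
  assumes "N \<ge> a" "a > 0"
  shows "(\<Sum>n=a..N. b n * f n) = (\<Sum>j\<le>N. b j) * f N - (\<Sum>j\<le>a-1. b j) * f a + (\<Sum>n=a..<N. (\<Sum>j\<le>n. b j) * (f n - f (Suc n)))"
  using assms(1)
proof (induction rule: dec_induct)
  case base
  have "{..a} = insert a {..a-1}" using assms(2) by auto
  then have "(\<Sum>j\<le>a. b j) = b a + (\<Sum>j\<le>a-1. b j)" using assms(2) by simp
  then show ?case by (simp add: algebra_simps)
next
  case (step N)
  then show ?case by (simp add: algebra_simps)
qed

text \<open>Mean value theorem for \<open>1 / ln u ^ k\<close>; its derivative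
  \<open>- k / (u * ln u ^ Suc k)\<close> is largest in modulus at the left end.\<close>

lemma inverse_ln_power_diff:
  assumes "n \<ge> 8"
  shows "0 \<le> 1 / ln (real n) ^ k - 1 / ln (real (Suc n)) ^ k"
    "1 / ln (real n) ^ k - 1 / ln (real (Suc n)) ^ k \<le> real k / (real n * ln (real n) ^ Suc k)"
proof -
  have ln: "ln u > 0" if "u \<ge> real n" for u using assms that by (simp add: ln_gt_zero)
  have deriv: "((\<lambda>u. 1 / ln u ^ k) has_real_derivative (- real k / (u * ln u ^ Suc k))) (at u)" if u: "u \<ge> real n" for u
  proof (cases "k = 0")
    case False
    have "u > 0" using u assms by simp
    have "((\<lambda>u. 1 / ln u ^ k) has_real_derivative (0 * ln u ^ k - 1 * (real k * (inverse u * ln u ^ (k - Suc 0)))) / (ln u ^ k * ln u ^ k)) (at u)"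
      using ln[OF u] \<open>u > 0\<close> by (intro DERIV_divide DERIV_const DERIV_power DERIV_ln) auto
    also have "(0 * ln u ^ k - 1 * (real k * (inverse u * ln u ^ (k - Suc 0)))) / (ln u ^ k * ln u ^ k) = - real k / (u * ln u ^ Suc k)"
      using False ln[OF u] \<open>u > 0\<close> by (cases k) (auto simp: field_simps)
    finally show ?thesis .
  qed auto
  obtain z where z: "z > real n" "z < real (Suc n)"
    "1 / ln (real (Suc n)) ^ k - 1 / ln (real n) ^ k = (real (Suc n) - real n) * (- real k / (z * ln z ^ Suc k))"
    using MVT2[of "real n" "real (Suc n)" "\<lambda>u. 1 / ln u ^ k" "\<lambda>u. - real k / (u * ln u ^ Suc k)"] deriv by auto
  then have eq: "1 / ln (real n) ^ k - 1 / ln (real (Suc n)) ^ k = real k / (z * ln z ^ Suc k)" by simp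
  have z0: "z > 0" "ln z > 0" using z assms ln[of z] by auto
  show "0 \<le> 1 / ln (real n) ^ k - 1 / ln (real (Suc n)) ^ k"
    unfolding eq using z0 by simp
  have "ln (real n) \<le> ln z" using z assms by (subst ln_le_cancel_iff) auto
  then show "1 / ln (real n) ^ k - 1 / ln (real (Suc n)) ^ k \<le> real k / (real n * ln (real n) ^ Suc k)"
    unfolding eq using z z0 assms ln[of "real n"]
    by (intro divide_left_mono mult_mono power_mono mult_pos_pos zero_less_power) auto
qed

text \<open>Split at \<open>sqrt N\<close>. Below, there are at most \<open>sqrt N\<close> terms,
  each at most 1; above, \<open>ln n\<close> is at least half of \<open>ln N\<close>.\<close>

lemma sum_inverse_ln_power:
  assumes "N \<ge> 8" "m > 0"
  shows "(\<Sum>n=8..<N. 1 / ln (real n) ^ Suc m) \<le> ((2 * real m) ^ m + 2 ^ Suc m) * (real N / ln (real N) ^ m)"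
proof -
  define L where "L = ln (real N)"
  have L: "L \<ge> 2" unfolding L_def using assms by (intro ln_ge_2) auto
  have le: "1 / ln (real n) ^ Suc m \<le> (if real n \<le> sqrt (real N) then 1 else 0) + 2 ^ Suc m / L ^ m" if n: "n \<in> {8..<N}" for n
  proof (cases "real n \<le> sqrt (real N)")
    case True
    have "1 \<le> ln (real n) ^ Suc m" using ln_ge_2[of "real n"] n by (intro one_le_power) auto
    then have "1 / ln (real n) ^ Suc m \<le> 1" by simp
    then show ?thesis using True L by (simp add: add_increasing2)
  next
    case False
    have "L / 2 = ln (sqrt (real N))" unfolding L_def using assms by (simp add: ln_sqrt)
    also have "\<dots> \<le> ln (real n)" using False assms n by (subst ln_le_cancel_iff) auto
    finally have "(L / 2) ^ Suc m \<le> ln (real n) ^ Suc m" using L by (intro power_mono) auto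
    moreover have "0 < (L / 2) ^ Suc m" using L by simp
    ultimately have "1 / ln (real n) ^ Suc m \<le> 1 / (L / 2) ^ Suc m"
      by (intro divide_left_mono mult_pos_pos) linarith+
    also have "\<dots> = 2 ^ Suc m / L ^ Suc m" by (simp add: power_divide)
    also have "\<dots> \<le> 2 ^ Suc m / L ^ m" using L by (intro divide_left_mono power_increasing) auto
    finally show ?thesis using False by simp
  qed
  have "(\<Sum>n=8..<N. 1 / ln (real n) ^ Suc m) \<le> (\<Sum>n=8..<N. (if real n \<le> sqrt (real N) then 1 else 0) + 2 ^ Suc m / L ^ m)"
    by (intro sum_mono le)
  also have "\<dots> = (\<Sum>n=8..<N. if real n \<le> sqrt (real N) then 1 else 0) + real (N - 8) * (2 ^ Suc m / L ^ m)"
    by (simp add: sum.distrib)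
  also have "(\<Sum>n=8..<N. if real n \<le> sqrt (real N) then 1 else 0) = real (card {n \<in> {8..<N}. real n \<le> sqrt (real N)})"
    by (simp add: sum.If_cases Int_def)
  also have "\<dots> \<le> sqrt (real N)"
  proof -
    have "card {n \<in> {8..<N}. real n \<le> sqrt (real N)} \<le> card {1..nat \<lfloor>sqrt (real N)\<rfloor>}"
      by (intro card_mono) (auto simp: le_nat_floor)
    also have "\<dots> = nat \<lfloor>sqrt (real N)\<rfloor>" by simp
    finally have "real (card {n \<in> {8..<N}. real n \<le> sqrt (real N)}) \<le> real (nat \<lfloor>sqrt (real N)\<rfloor>)" by (rule of_nat_mono)
    also have "\<dots> \<le> sqrt (real N)" by (intro of_nat_floor) auto
    finally show ?thesis .
  qed
  also have "sqrt (real N) \<le> (2 * real m) ^ m * (real N / L ^ m)"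
  proof -
    have "(L / 2) ^ m \<le> real m ^ m * sqrt (real N)"
      using ln_power_le[of "sqrt (real N)" m] assms by (simp add: L_def ln_sqrt)
    then have "L ^ m \<le> (2 * real m) ^ m * sqrt (real N)"
      by (simp add: power_divide power_mult_distrib field_simps)
    then have "L ^ m * sqrt (real N) \<le> (2 * real m) ^ m * sqrt (real N) * sqrt (real N)"
      by (intro mult_right_mono) auto
    also have "\<dots> = (2 * real m) ^ m * real N" by (simp add: mult.assoc)
    finally show ?thesis using L by (simp add: pos_le_divide_eq mult.commute)
  qed
  also have "real (N - 8) * (2 ^ Suc m / L ^ m) \<le> real N * (2 ^ Suc m / L ^ m)"
    using L by (intro mult_right_mono) auto
  finally show ?thesis by (simp add: L_def algebra_simps)
qed

definition psi :: "real \<Rightarrow> real" where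
  "psi x = (\<Sum>n\<le>nat \<lfloor>x\<rfloor>. mangoldt n)"

text \<open>Partial sums of size \<open>n * ln n ^ m\<close> meet the weight
  \<open>1 / ln n ^ (2 * m)\<close>. The upper boundary term becomes \<open>N / ln N ^ m\<close>,
  and each difference of weights leaves a multiple of \<open>1 / ln n ^ Suc m\<close>.\<close>

lemma psi_nat_bound:
  assumes m: "m > 0"
  obtains C where "C > 0" "\<And>N. N \<ge> 8 \<Longrightarrow> \<bar>psi (real N) - real N\<bar> \<le> C * (real N / ln (real N) ^ m)"
proof -
  obtain A where A: "A > 0" "\<And>x. x \<ge> 8 \<Longrightarrow> \<bar>partial_sum (ln_mangoldt (2 * m)) x - partial_sum (ln_power (2 * m)) x\<bar> \<le> A * x * ln x ^ m"
    using m by (rule partial_sum_diff_bound) (rule that, assumption, blast)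
  define b where "b = (\<lambda>n. ln_mangoldt (2 * m) n - ln_power (2 * m) n)"
  define f where "f = (\<lambda>n. 1 / ln (real n) ^ (2 * m))"
  define B where "B = (\<lambda>n. \<Sum>j\<le>n. b j)"
  have B: "\<bar>B n\<bar> \<le> A * real n * ln (real n) ^ m" if "n \<ge> 8" for n
    using A(2)[of "real n"] that by (simp add: B_def b_def partial_sum_def sum_subtractf)
  \<comment> \<open>The sum starts at 8 to keep the logarithms away from 0; \<open>c0\<close>
    collects the terms below 8 and the lower boundary term.\<close>
  define c0 where "c0 = \<bar>\<Sum>n=1..7. mangoldt n - 1\<bar> + \<bar>B 7\<bar> * f 8"
  define C where "C = A + 2 * real m * A * ((2 * real m) ^ m + 2 ^ Suc m) + c0 * real m ^ m"
  have c0: "c0 \<ge> 0" by (auto simp: c0_def f_def)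
  show ?thesis
  proof (rule that)
    show "C > 0" unfolding C_def using A c0 by (intro add_pos_nonneg) auto
    fix N :: nat assume N: "N \<ge> 8"
    define L where "L = ln (real N)"
    have L: "L \<ge> 2" unfolding L_def using N by (intro ln_ge_2) auto
    define Q where "Q = real N / L ^ m"
    have Q: "Q \<ge> 0" using L by (simp add: Q_def)
    have "psi (real N) = (\<Sum>n\<in>insert 0 {1..N}. mangoldt n)"
      unfolding psi_def by (intro sum.cong) auto
    then have "psi (real N) - real N = (\<Sum>n=1..N. mangoldt n - 1)" by (simp add: sum_subtractf)
    also have "{1..N} = {1..7} \<union> {8..N}" using N by auto
    also have "(\<Sum>n\<in>\<dots>. mangoldt n - 1 :: real) = (\<Sum>n=1..7. mangoldt n - 1) + (\<Sum>n=8..N. mangoldt n - 1)"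
      by (intro sum.union_disjoint) auto
    also have "(\<Sum>n=8..N. mangoldt n - 1 :: real) = (\<Sum>n=8..N. b n * f n)"
    proof (rule sum.cong)
      fix n assume "n \<in> {8..N}"
      then have "ln (real n) \<noteq> 0" using ln_ge_2[of "real n"] by simp
      then show "mangoldt n - 1 = b n * f n" using \<open>n \<in> _\<close> by (simp add: b_def f_def ln_mangoldt_def ln_power_def field_simps)
    qed auto
    also have "\<dots> = B N * f N - B 7 * f 8 + (\<Sum>n=8..<N. B n * (f n - f (Suc n)))"
      using abel_summation[of 8 N b f] N by (simp add: B_def)
    finally have eq: "psi (real N) - real N = (\<Sum>n=1..7. mangoldt n - 1) + (B N * f N - B 7 * f 8 + (\<Sum>n=8..<N. B n * (f n - f (Suc n))))" .
    have fnn: "f n \<ge> 0" for n by (simp add: f_def)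
    have 1: "\<bar>B N * f N\<bar> \<le> A * Q"
    proof -
      have "\<bar>B N * f N\<bar> \<le> A * real N * L ^ m * f N"
        unfolding abs_mult using fnn[of N] B[OF N] by (simp add: L_def mult_right_mono)
      also have "\<dots> = A * Q" using L by (simp add: f_def Q_def L_def[symmetric] mult_2 power_add)
      finally show ?thesis .
    qed
    have 2: "\<bar>\<Sum>n=8..<N. B n * (f n - f (Suc n))\<bar> \<le> 2 * real m * A * ((2 * real m) ^ m + 2 ^ Suc m) * Q"
    proof -
      have "\<bar>B n * (f n - f (Suc n))\<bar> \<le> 2 * real m * A * (1 / ln (real n) ^ Suc m)" if n: "n \<in> {8..<N}" for n
      proof -
        have l: "ln (real n) \<ge> 2" using n by (intro ln_ge_2) auto
        have "\<bar>B n * (f n - f (Suc n))\<bar> \<le> (A * real n * ln (real n) ^ m) * (real (2 * m) / (real n * ln (real n) ^ Suc (2 * m)))"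
          unfolding abs_mult using inverse_ln_power_diff[of n "2 * m"] n B[of n] A
          by (intro mult_mono) (auto simp: f_def)
        also have "\<dots> = 2 * real m * A * (1 / ln (real n) ^ Suc m)"
        proof -
          have "(A * r * p) * (real (2 * m) / (r * (q * (p * p)))) = 2 * real m * A * (1 / (q * p))"
            if "r \<noteq> 0" "p \<noteq> 0" "q \<noteq> 0" for r p q :: real using that by simp
          moreover have "ln (real n) ^ (2 * m) = ln (real n) ^ m * ln (real n) ^ m"
            by (simp add: mult_2 power_add)
          ultimately show ?thesis using n l by simp
        qed
        finally show ?thesis .
      qed
      then have "\<bar>\<Sum>n=8..<N. B n * (f n - f (Suc n))\<bar> \<le> (\<Sum>n=8..<N. 2 * real m * A * (1 / ln (real n) ^ Suc m))"
        by (intro order_trans[OF sum_abs] sum_mono)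
      also have "\<dots> = 2 * real m * A * (\<Sum>n=8..<N. 1 / ln (real n) ^ Suc m)"
        by (simp add: sum_distrib_left)
      also have "\<dots> \<le> 2 * real m * A * (((2 * real m) ^ m + 2 ^ Suc m) * Q)"
        unfolding Q_def L_def using A N m by (intro mult_left_mono sum_inverse_ln_power) auto
      finally show ?thesis by simp
    qed
    have 3: "c0 \<le> c0 * real m ^ m * Q"
    proof -
      have "1 \<le> real m ^ m * Q" using ln_power_le[of "real N" m] N m L by (simp add: L_def Q_def)
      from mult_left_mono[OF this c0] show ?thesis by (simp add: mult_ac)
    qed
    have "\<bar>psi (real N) - real N\<bar> \<le> A * Q + 2 * real m * A * ((2 * real m) ^ m + 2 ^ Suc m) * Q + c0"
    proof -
      have tri: "\<bar>s + (x - y + z)\<bar> \<le> \<bar>x\<bar> + \<bar>z\<bar> + (\<bar>s\<bar> + \<bar>y\<bar>)" for s x y z :: real by linarith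
      have "\<bar>B 7 * f 8\<bar> = \<bar>B 7\<bar> * f 8" using fnn[of 8] by (simp add: abs_mult)
      then show ?thesis
        unfolding eq c0_def by (intro order_trans[OF tri] add_mono 1 2) simp_all
    qed
    also have "\<dots> \<le> C * Q" using 3 unfolding C_def distrib_right by simp
    finally show "\<bar>psi (real N) - real N\<bar> \<le> C * (real N / ln (real N) ^ m)"
      by (simp add: Q_def L_def)
  qed
qed

text \<open>\<open>psi\<close> is constant between integers. Rounding \<open>x\<close> down to
  \<open>N\<close> moves the main term by at most 1, and \<open>ln x \<le> 2 * ln N\<close> costs a
  factor \<open>2 ^ m\<close> in the error.\<close>

lemma psi_bound:
  assumes m: "m > 0"
  obtains C where "C > 0" "\<And>x. x \<ge> 8 \<Longrightarrow> \<bar>psi x - x\<bar> \<le> C * (x / ln x ^ m)"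
proof -
  obtain C where C: "C > 0" "\<And>N. N \<ge> 8 \<Longrightarrow> \<bar>psi (real N) - real N\<bar> \<le> C * (real N / ln (real N) ^ m)"
    using m by (rule psi_nat_bound) (rule that, assumption, blast)
  show ?thesis
  proof (rule that)
    show "C * 2 ^ m + real m ^ m > 0" using C by (simp add: add_pos_nonneg)
    fix x :: real assume x: "x \<ge> 8"
    define N where "N = nat \<lfloor>x\<rfloor>"
    have N: "N \<ge> 8" "real N \<le> x" "x < real N + 1" using x by (auto simp: N_def le_nat_iff le_floor_iff)
    have psi: "psi x = psi (real N)" by (simp add: psi_def N_def)
    have l: "ln x \<ge> 2" using x by (rule ln_ge_2)
    have "x \<le> real N * real N"
    proof -
      have "real N + 1 \<le> 8 * real N" using N by simp
      also have "\<dots> \<le> real N * real N" using N by (intro mult_right_mono) auto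
      finally show ?thesis using N by simp
    qed
    then have "ln x \<le> ln (real N * real N)" using x N by (subst ln_le_cancel_iff) auto
    also have "\<dots> = 2 * ln (real N)" using N by (simp add: ln_mult)
    finally have lN: "ln x / 2 \<le> ln (real N)" by simp
    then have "(ln x / 2) ^ m \<le> ln (real N) ^ m" using l by (intro power_mono) auto
    then have "real N / ln (real N) ^ m \<le> x / (ln x / 2) ^ m"
      using N l x by (intro frac_le) auto
    also have "x / (ln x / 2) ^ m = 2 ^ m * (x / ln x ^ m)" by (simp add: power_divide)
    finally have "C * (real N / ln (real N) ^ m) \<le> C * (2 ^ m * (x / ln x ^ m))"
      using C by (intro mult_left_mono) auto
    then have 1: "C * (real N / ln (real N) ^ m) \<le> C * 2 ^ m * (x / ln x ^ m)"
      by (simp only: mult.assoc)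
    have 2: "1 \<le> real m ^ m * (x / ln x ^ m)"
      using ln_power_le[of x m] x m l by simp
    have "\<bar>psi x - x\<bar> \<le> C * (real N / ln (real N) ^ m) + 1"
      using C(2)[OF N(1)] N unfolding psi by linarith
    also have "\<dots> \<le> (C * 2 ^ m + real m ^ m) * (x / ln x ^ m)"
      using 1 2 by (simp only: distrib_right)
    finally show "\<bar>psi x - x\<bar> \<le> (C * 2 ^ m + real m ^ m) * (x / ln x ^ m)" .
  qed
qed

section \<open>Comparison of prime counts\<close>

abbreviation primes_upto :: "real \<Rightarrow> nat set" where
  "primes_upto x \<equiv> {p. prime p \<and> real p \<le> x}"

definition theta :: "real \<Rightarrow> real" where
  "theta x = (\<Sum>p\<in>primes_upto x. ln (real p))"

lemma finite_primes_upto [simp]: "finite (primes_upto x)"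
  by (rule finite_subset[of _ "{..nat \<lfloor>x\<rfloor>}"]) (auto simp: le_nat_floor)

text \<open>Each prime beyond \<open>x\<close> has weight \<open>ln p \<ge> ln x\<close> in
  \<open>psi\<close>, and prime powers only add to the right-hand side.\<close>

lemma prime_pi_diff_le:
  assumes x: "x > 1" and h: "h \<ge> 0"
  shows "(real (prime_pi (x + h)) - real (prime_pi x)) * ln x \<le> psi (x + h) - psi x"
proof -
  define D where "D = {nat \<lfloor>x\<rfloor><..nat \<lfloor>x + h\<rfloor>}"
  define Q where "Q = {p. prime p \<and> x < real p \<and> real p \<le> x + h}"
  have QD: "Q \<subseteq> D"
    using x h by (auto simp: Q_def D_def nat_less_iff le_nat_iff floor_less_iff le_floor_iff)
  then have fin: "finite Q" by (rule finite_subset) (simp add: D_def)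
  have "primes_upto (x + h) = primes_upto x \<union> Q" using h by (auto simp: Q_def)
  moreover have "primes_upto x \<inter> Q = {}" by (auto simp: Q_def)
  ultimately have "prime_pi (x + h) = prime_pi x + card Q"
    unfolding prime_pi_def using fin by (simp add: card_Un_disjoint)
  then have "(real (prime_pi (x + h)) - real (prime_pi x)) * ln x = (\<Sum>p\<in>Q. ln x)" by simp
  also have "\<dots> \<le> (\<Sum>p\<in>Q. mangoldt p)"
    using x by (intro sum_mono) (auto simp: Q_def)
  also have "\<dots> \<le> (\<Sum>n\<in>D. mangoldt n)"
    by (intro sum_mono2 QD) (auto simp: D_def mangoldt_nonneg)
  also have "\<dots> = psi (x + h) - psi x"
    unfolding psi_def D_def using x h by (subst sum_atMost_floor_split) auto
  finally show ?thesis .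
qed

text \<open>A proper prime power \<open>p ^ k \<le> x\<close> has \<open>p \<le> sqrt x\<close> and
  \<open>k \<le> log 2 x\<close>. Counting the pairs crudely, with weight \<open>ln x\<close> each,
  is enough next to an error of order \<open>x / ln x ^ 3\<close>.\<close>

lemma psi_le_theta:
  assumes x: "x \<ge> 1"
  shows "psi x \<le> theta x + (sqrt x + 1) * (log 2 x + 1) * ln x"
proof -
  define A where "A = {n. primepow n \<and> \<not> prime n \<and> real n \<le> x}"
  define B where "B = {..nat \<lfloor>sqrt x\<rfloor>} \<times> {..nat \<lfloor>log 2 x\<rfloor>}"
  have AB: "A \<subseteq> (\<lambda>(p, k). p ^ k) ` B"
  proof
    fix n assume n: "n \<in> A"
    then obtain p k where pk: "prime p" "k > 0" "n = p ^ k" unfolding A_def primepow_def by auto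
    have k: "k \<ge> 2" using n pk by (cases "k = 1") (auto simp: A_def)
    have p: "p \<ge> 2" using pk by (simp add: prime_ge_2_nat)
    have "real p ^ 2 \<le> real p ^ k" using p k by (intro power_increasing) auto
    also have "\<dots> \<le> x" using n pk by (simp add: A_def)
    finally have "real p \<le> sqrt x" by (rule real_le_rsqrt)
    moreover have "(2 :: real) ^ k \<le> real p ^ k" using p by (intro power_mono) auto
    then have "2 ^ k \<le> x" by (rule order_trans) (use n pk in \<open>simp add: A_def\<close>)
    then have "real k \<le> log 2 x" using x by (simp add: le_log_iff powr_realpow)
    ultimately have "(p, k) \<in> B" by (auto simp: B_def le_nat_floor)
    then show "n \<in> (\<lambda>(p, k). p ^ k) ` B" using pk by force
  qed
  have finA: "finite A" by (rule finite_subset[OF AB]) (simp add: B_def)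
  have "card A \<le> card B"
    using card_mono[OF _ AB] card_image_le[of B "\<lambda>(p, k). p ^ k"] by (fastforce simp: B_def)
  then have "real (card A) \<le> real (card B)" by (rule of_nat_mono)
  also have "\<dots> = (real (nat \<lfloor>sqrt x\<rfloor>) + 1) * (real (nat \<lfloor>log 2 x\<rfloor>) + 1)" by (simp add: B_def algebra_simps)
  also have "\<dots> \<le> (sqrt x + 1) * (log 2 x + 1)"
    using x by (intro mult_mono add_right_mono of_nat_floor) auto
  finally have card: "real (card A) \<le> (sqrt x + 1) * (log 2 x + 1)" .
  have le: "real n \<le> x" if "n \<le> nat \<lfloor>x\<rfloor>" for n
    using that x by (simp add: le_nat_iff le_floor_iff)
  have "psi x = (\<Sum>n\<in>primes_upto x \<union> A. mangoldt n)"
    unfolding psi_def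
  proof (rule sum.mono_neutral_right)
    show "primes_upto x \<union> A \<subseteq> {..nat \<lfloor>x\<rfloor>}" by (auto simp: A_def le_nat_floor)
    show "\<forall>n\<in>{..nat \<lfloor>x\<rfloor>} - (primes_upto x \<union> A). mangoldt n = (0 :: real)"
      using le by (auto simp: A_def mangoldt_def)
  qed auto
  also have "\<dots> = (\<Sum>p\<in>primes_upto x. mangoldt p) + (\<Sum>n\<in>A. mangoldt n)"
    using finA by (intro sum.union_disjoint) (auto simp: A_def)
  also have "(\<Sum>p\<in>primes_upto x. mangoldt p) = theta x"
    unfolding theta_def by (intro sum.cong) auto
  also have "(\<Sum>n\<in>A. mangoldt n) \<le> (\<Sum>n\<in>A. ln x)"
  proof (rule sum_mono)
    fix n assume n: "n \<in> A"
    then have "n > 0" by (auto simp: A_def intro!: Nat.gr0I)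
    then have "mangoldt n \<le> ln (real n)" by (rule mangoldt_le_ln)
    also have "\<dots> \<le> ln x" using n \<open>n > 0\<close> x by (subst ln_le_cancel_iff) (auto simp: A_def)
    finally show "mangoldt n \<le> ln x" .
  qed
  also have "(\<Sum>n\<in>A. ln x) \<le> (sqrt x + 1) * (log 2 x + 1) * ln x"
    using card x by (simp add: mult_right_mono)
  finally show ?thesis by simp
qed

text \<open>The primes up to \<open>y / 2\<close> are counted with a weight that is short of \<open>ln y\<close> by at least \<open>ln 2\<close>. This gain of order
\<open>y / ln y\<close> is the source of the strict inequality.\<close>

lemma theta_le_prime_pi:
  assumes y: "y \<ge> 1"
  shows "theta y \<le> real (prime_pi y) * ln y - ln 2 * real (prime_pi (y / 2))"
proof -
  have "theta y \<le> (\<Sum>p\<in>primes_upto y. ln y - (if real p \<le> y / 2 then ln 2 else 0))"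
    unfolding theta_def
  proof (rule sum_mono)
    fix p assume "p \<in> primes_upto y"
    then have p: "real p > 0" "real p \<le> y" by (auto simp: prime_gt_0_nat)
    show "ln (real p) \<le> ln y - (if real p \<le> y / 2 then ln 2 else 0)"
    proof (cases "real p \<le> y / 2")
      case True
      then have "ln (real p) \<le> ln (y / 2)" using p y by (subst ln_le_cancel_iff) auto
      then show ?thesis using True y by (simp add: ln_div)
    next
      case False
      then show ?thesis using p y by simp
    qed
  qed
  also have "\<dots> = real (prime_pi y) * ln y - (\<Sum>p\<in>primes_upto y. if real p \<le> y / 2 then ln 2 else 0)"
    by (simp add: sum_subtractf prime_pi_def)
  also have "(\<Sum>p\<in>primes_upto y. if real p \<le> y / 2 then ln 2 else 0) = (\<Sum>p\<in>primes_upto (y / 2). ln 2)"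
    using y by (intro sum.mono_neutral_cong_right) auto
  also have "\<dots> = ln 2 * real (prime_pi (y / 2))" by (simp add: prime_pi_def)
  finally show ?thesis .
qed

text \<open>\<open>e\<close> is the error in the lower bound for \<open>theta\<close>, and the last
  summand is \<open>ln 2\<close> times the resulting lower bound for the primes up to
  \<open>y / 2\<close>. In units of \<open>y / ln y\<close> the gain tends to
  \<open>ln 2 / 2\<close>, the errors to 0; 1/16 is a safe fraction.\<close>

lemma asymptotic_gain:
  fixes C :: real
  defines "e \<equiv> (\<lambda>z. C * (z / ln z ^ 3) + (sqrt z + 1) * (log 2 z + 1) * ln z)"
  shows "\<forall>\<^sub>F y in at_top. y + y / (16 * ln y) \<le> y - e y + ln 2 * ((y / 2 - e (y / 2)) / ln (y / 2))"
proof -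
  have "((\<lambda>y. (- e y + ln 2 * ((y / 2 - e (y / 2)) / ln (y / 2))) / (y / ln y)) \<longlongrightarrow> ln 2 / 2) at_top"
    unfolding e_def by real_asymp
  moreover have "ln 2 / 2 > (1/16 :: real)" using ln2_ge_two_thirds by simp
  ultimately have "\<forall>\<^sub>F y in at_top. (- e y + ln 2 * ((y / 2 - e (y / 2)) / ln (y / 2))) / (y / ln y) > 1/16"
    by (rule order_tendstoD)
  then show ?thesis using eventually_gt_at_top[of 1]
  proof eventually_elim
    case (elim y)
    then have "y / ln y > 0" by simp
    with elim(1) have "1/16 * (y / ln y) < - e y + ln 2 * ((y / 2 - e (y / 2)) / ln (y / 2))"
      by (simp only: pos_less_divide_eq)
    then show ?case by simp
  qed
qed

text \<open>The lower bound for \<open>theta\<close> is used twice: at \<open>y\<close> for the main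
  term, and at \<open>y / 2\<close> to show that the undercounted primes are numerous.\<close>

lemma prime_pi_lower:
  "\<forall>\<^sub>F y in at_top. y + y / (16 * ln y) \<le> real (prime_pi y) * ln y"
proof -
  obtain C where C: "C > 0" "\<And>x. x \<ge> 8 \<Longrightarrow> \<bar>psi x - x\<bar> \<le> C * (x / ln x ^ 3)"
    by (rule psi_bound[of 3]) (simp, rule that, assumption, blast)
  define e where "e = (\<lambda>z. C * (z / ln z ^ 3) + (sqrt z + 1) * (log 2 z + 1) * ln z)"
  have theta: "theta z \<ge> z - e z" if "z \<ge> 8" for z
    using C(2)[OF that] psi_le_theta[of z] that by (simp add: e_def)
  have "\<forall>\<^sub>F y in at_top. y + y / (16 * ln y) \<le> y - e y + ln 2 * ((y / 2 - e (y / 2)) / ln (y / 2))"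
    unfolding e_def by (rule asymptotic_gain)
  then show ?thesis using eventually_ge_at_top[of 16]
  proof eventually_elim
    case (elim y)
    have l: "ln (y / 2) > 0" using elim by (intro ln_gt_zero) auto
    have "y / 2 - e (y / 2) \<le> theta (y / 2)" using elim by (intro theta) auto
    also have "\<dots> \<le> real (prime_pi (y / 2)) * ln (y / 2)"
      using theta_le_prime_pi[of "y / 2"] elim by (simp add: add_increasing2 order_trans)
    finally have "(y / 2 - e (y / 2)) / ln (y / 2) \<le> real (prime_pi (y / 2))"
      using l by (simp only: pos_divide_le_eq)
    then have "ln 2 * ((y / 2 - e (y / 2)) / ln (y / 2)) \<le> ln 2 * real (prime_pi (y / 2))"
      by (intro mult_left_mono) auto
    then show ?case
      using elim theta[of y] theta_le_prime_pi[of y] by linarith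
  qed
qed

theorem theorem1p1:
  fixes c :: real
  assumes "c \<ge> 0"
  shows "\<exists>X0 :: real. X0 \<ge> 2 \<and>
    (\<forall>x y :: real. x \<ge> X0 \<longrightarrow> x * (ln x) powr (- c) \<le> y \<longrightarrow> y \<le> x \<longrightarrow>
       prime_pi (x + y) < prime_pi x + prime_pi y)"
proof -
  define q where "q = nat \<lceil>c\<rceil>"
  \<comment> \<open>Of the \<open>m\<close> logarithms, \<open>q\<close> make up for
    \<open>y\<close> being smaller than \<open>x\<close>, one for the gain being
    \<open>y / ln y\<close>, and two remain to beat the constant.\<close>
  define m where "m = q + 3"
  have q: "c \<le> real q" unfolding q_def by (rule real_nat_ceiling_ge)
  have m: "m > 0" by (simp add: m_def)
  obtain C where C: "C > 0" "\<And>x. x \<ge> 8 \<Longrightarrow> \<bar>psi x - x\<bar> \<le> C * (x / ln x ^ m)"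
    using m by (rule psi_bound) (rule that, assumption, blast)
  from prime_pi_lower obtain Y0 where Y0: "\<And>y. y \<ge> Y0 \<Longrightarrow> y + y / (16 * ln y) \<le> real (prime_pi y) * ln y"
    by (auto simp: eventually_at_top_linorder)
  define Y where "Y = max Y0 8"
  \<comment> \<open>The three conditions force \<open>y \<ge> Y\<close>, \<open>ln x \<ge> 2\<close>
    and \<open>ln x > 48 * C\<close>. Here 48 is 3 * 16: the error is \<open>3 * C\<close> times
    \<open>x / ln x ^ m\<close>, the gain \<open>y / (16 * ln x)\<close>.\<close>
  have "\<forall>\<^sub>F x in at_top. (Y * (2 * real m) ^ m)\<^sup>2 \<le> x \<and> 8 \<le> x \<and> exp (48 * C + 1) \<le> (x :: real)"
    by (intro eventually_conj eventually_ge_at_top)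
  then obtain X where X: "\<And>x. x \<ge> X \<Longrightarrow> (Y * (2 * real m) ^ m)\<^sup>2 \<le> x \<and> 8 \<le> x \<and> exp (48 * C + 1) \<le> x"
    unfolding eventually_at_top_linorder by blast
  have main: "prime_pi (x + y) < prime_pi x + prime_pi y"
    if xy: "x \<ge> X" "x * (ln x) powr (- c) \<le> y" "y \<le> x" for x y
  proof -
    define L where "L = ln x"
    have x: "x \<ge> 8" "(Y * (2 * real m) ^ m)\<^sup>2 \<le> x" "exp (48 * C + 1) \<le> x" using X[OF xy(1)] by auto
    have L: "L \<ge> 2" unfolding L_def using x by (intro ln_ge_2) auto
    have LC: "L \<ge> 48 * C + 1" unfolding L_def using x by (subst ln_ge_iff) auto
    have "L powr c \<le> L powr real q" using L q by (intro powr_mono) auto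
    then have "1 / L ^ q \<le> L powr (- c)"
      using L by (simp add: powr_minus powr_realpow divide_inverse le_imp_inverse_le)
    then have "x * (1 / L ^ q) \<le> x * L powr (- c)" using x by (intro mult_left_mono) auto
    then have yq: "x / L ^ q \<le> y" using xy by (simp add: L_def)
    have yY: "y \<ge> Y"
    proof -
      have "(L / 2) ^ m \<le> real m ^ m * sqrt x"
        using ln_power_le[of "sqrt x" m] m x by (simp add: L_def ln_sqrt)
      then have Lm: "L ^ m \<le> (2 * real m) ^ m * sqrt x"
        by (simp add: power_divide power_mult_distrib field_simps)
      have "Y * (2 * real m) ^ m \<le> sqrt x" using x(2) by (rule real_le_rsqrt)
      then have "Y * ((2 * real m) ^ m * sqrt x) \<le> sqrt x * sqrt x"
        unfolding mult.assoc[symmetric] using x by (intro mult_right_mono) auto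
      moreover have "Y * L ^ m \<le> Y * ((2 * real m) ^ m * sqrt x)"
        using Lm by (intro mult_left_mono) (auto simp: Y_def)
      moreover have "Y * L ^ q \<le> Y * L ^ m"
        using L by (intro mult_left_mono power_increasing) (auto simp: Y_def m_def)
      ultimately have "Y * L ^ q \<le> x" using x by simp
      then have "Y \<le> x / L ^ q" using L by (simp add: pos_le_divide_eq)
      then show ?thesis using yq by simp
    qed
    then have y: "y \<ge> 8" "y \<ge> Y0" by (auto simp: Y_def)
    define l where "l = ln y"
    have l: "l \<ge> 2" unfolding l_def using y by (intro ln_ge_2) auto
    have lL: "l \<le> L" unfolding l_def L_def using xy y by (subst ln_le_cancel_iff) auto
    \<comment> \<open>The error constant is \<open>2 * C\<close> at \<open>x + y \<le> 2 * x\<close>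
      plus \<open>C\<close> at \<open>x\<close>.\<close>
    have up: "(real (prime_pi (x + y)) - real (prime_pi x)) * L \<le> y + 3 * C * (x / L ^ m)"
    proof -
      have "(real (prime_pi (x + y)) - real (prime_pi x)) * L \<le> psi (x + y) - psi x"
        unfolding L_def using x y by (intro prime_pi_diff_le) auto
      moreover have "psi (x + y) \<le> x + y + C * ((x + y) / ln (x + y) ^ m)"
        using C(2)[of "x + y"] x y by auto
      moreover have "C * ((x + y) / ln (x + y) ^ m) \<le> C * (2 * x / L ^ m)"
      proof -
        have "L \<le> ln (x + y)" unfolding L_def using x y by (subst ln_le_cancel_iff) auto
        then have "L ^ m \<le> ln (x + y) ^ m" using L by (intro power_mono) auto
        then show ?thesis using C x y xy L by (intro mult_left_mono frac_le) auto
      qed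
      moreover have "psi x \<ge> x - C * (x / L ^ m)"
        using C(2)[of x] x by (auto simp: L_def)
      moreover have "C * (2 * x / L ^ m) = 2 * (C * (x / L ^ m))" by simp
      moreover have "P \<le> y + 3 * E" if "P \<le> u - v" "u \<le> x + y + w" "w \<le> z" "x - E \<le> v" "z = 2 * E" for P u v w z E
        using that by linarith
      ultimately show ?thesis unfolding mult.assoc[of 3] by blast
    qed
    have err: "48 * C * (x / L ^ m) < y / L"
    proof -
      have "48 * C < L * L"
      proof -
        have "48 * C < L * 1" using LC by simp
        also have "\<dots> \<le> L * L" using L by (intro mult_left_mono) auto
        finally show ?thesis .
      qed
      then have "48 * C * (x / L ^ m) < L * L * (x / L ^ m)"
        using x L by (intro mult_strict_right_mono) auto
      also have "\<dots> = (x / L ^ q) / L"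
        using L by (simp add: m_def power_add eval_nat_numeral)
      also have "\<dots> \<le> y / L" using yq L by (intro divide_right_mono) auto
      finally show ?thesis .
    qed
    have "(real (prime_pi (x + y)) - real (prime_pi x)) * L < y + y / (16 * L)"
      using up err by simp
    \<comment> \<open>The weight \<open>ln x\<close> of the first count has to be matched with the
      weight \<open>ln y\<close> of the second; as \<open>y \<le> x\<close>, both changes go in the
      right direction.\<close>
    also have "\<dots> \<le> (y + y / (16 * l)) * (L / l)"
    proof -
      have "y / (16 * L) \<le> y / (16 * l)" using lL l y by (intro divide_left_mono) auto
      moreover have "(y + y / (16 * l)) * 1 \<le> (y + y / (16 * l)) * (L / l)"
        using lL l y by (intro mult_left_mono) auto
      ultimately show ?thesis by simp
    qed
    also have "\<dots> \<le> (real (prime_pi y) * l) * (L / l)"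
      using Y0[OF y(2)] l lL by (intro mult_right_mono) (auto simp: l_def)
    also have "\<dots> = real (prime_pi y) * L" using l by simp
    finally have "real (prime_pi (x + y)) - real (prime_pi x) < real (prime_pi y)"
      using L by (simp add: mult_less_cancel_right)
    then have "real (prime_pi (x + y)) < real (prime_pi x + prime_pi y)" by simp
    then show ?thesis by (simp only: of_nat_less_iff)
  qed
  show ?thesis
    by (rule exI[of _ "max X 2"]) (use main in auto)
qed

end
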